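(* Let $n\ge 1$ and $\omega>0$. For $i=1,\dots,n$ let $a_i,b_i\in C(\mathbb{R},[0,\infty))$ be $\omega$-periodic with $\bar a_i>0$ and $\bar b_i>0$, let $\tau\in C(\mathbb{R},\mathbb{R})$ be $\omega$-periodic, and let $f^i:\mathbb{R}_+^n\to[0,\infty)$ be continuous with $f^i(\mathbf{x})>0$ whenever $\|\mathbf{x}\|>0$. Assume that the limits $f_0^i$ and $f_\infty^i$ exist in $[0,\infty]$ for each $i$, and that $i_0=i_\infty=0$. If $$\frac{1}{\sigma\Gamma}\,\frac{1}{\max\{\mathbf{F}_0,\mathbf{F}_\infty\}}<\lambda<\frac{1}{\chi}\,\frac{1}{\min\{\mathbf{F}_0,\mathbf{F}_\infty\}},$$ then the system $$x_i'(t)=-a_i(t)x_i(t)+\lambda b_i(t) f^i(\mathbf{x}(t-\tau(t))),\qquad i=1,\dots,n,$$ has a positive $\omega$-periodic solution.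
   Context: Notation: $\mathbb{R}_+=[0,\infty)$, $\mathbb{R}_+^n$ is the nonnegative orthant, $\|\mathbf{x}\|=\sum_{i=1}^n|x_i|$ for $\mathbf{x}\in\mathbb{R}_+^n$, and $\bar g=\frac1\omega\int_0^\omega g(s)\,ds$ for an $\omega$-periodic function $g$. Constants: $\sigma_i=e^{-\bar a_i\omega}$, $\sigma=\min_{1\le i\le n}\sigma_i$, $$\Gamma=\min_{1\le i\le n}\frac{\bar b_i\omega}{\sigma_i^{-1}-1},\qquad \chi=\sum_{i=1}^n\frac{\sigma_i^{-1}}{\sigma_i^{-1}-1}\,\bar b_i\omega.$$ Limits: $f_0^i=\lim_{\|\mathbf{x}\|\to0}\frac{f^i(\mathbf{x})}{\|\mathbf{x}\|}$ and $f_\infty^i=\lim_{\|\mathbf{x}\|\to\infty}\frac{f^i(\mathbf{x})}{\|\mathbf{x}\|}$ (over $\mathbf{x}\in\mathbb{R}_+^n\setminus\{0\}$, values in $[0,\infty]$); $\mathbf{F}_0=\max_i f_0^i$, $\mathbf{F}_\infty=\max_i f_\infty^i$. $i_0$ is the number of zeros among $\mathbf{F}_0,\mathbf{F}_\infty$, and $i_\infty$ is the number of infinities among $\mathbf{F}_0,\mathbf{F}_\infty$; thus $i_0=i_\infty=0$ means $0<\mathbf{F}_0<\infty$ and $0<\mathbf{F}_\infty<\infty$. A solution $\mathbf{x}(t)=(x_1(t),\dots,x_n(t))$, $t\in\mathbb{R}$, is called positive if $x_i(t)\ge0$ for all $t\in\mathbb{R}$ and all $i$, and there is at least one component which is positive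 on all of $\mathbb{R}$. *)

theory Defs
  imports "HOL-Analysis.Analysis" "HOL-Library.Periodic_Fun"
begin

definition l1norm :: "real ^ 'n \<Rightarrow> real" where
  "l1norm x = (\<Sum>i\<in>UNIV. \<bar>x $ i\<bar>)"

definition orthant :: "(real ^ 'n) set" where
  "orthant = {x. \<forall>i. 0 \<le> x $ i}"

definition mean :: "real \<Rightarrow> (real \<Rightarrow> real) \<Rightarrow> real" where
  "mean \<omega> g = (1 / \<omega>) * integral {0..\<omega>} g"

definition sigma_comp :: "real \<Rightarrow> ('n \<Rightarrow> real \<Rightarrow> real) \<Rightarrow> 'n \<Rightarrow> real" where
  "sigma_comp \<omega> a i = exp (- mean \<omega> (a i) * \<omega>)"

definition sigma_min :: "real \<Rightarrow> ('n::finite \<Rightarrow> real \<Rightarrow> real) \<Rightarrow> real" where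
  "sigma_min \<omega> a = (MIN i. sigma_comp \<omega> a i)"

definition Gamma_const ::
  "real \<Rightarrow> ('n::finite \<Rightarrow> real \<Rightarrow> real) \<Rightarrow> ('n \<Rightarrow> real \<Rightarrow> real) \<Rightarrow> real" where
  "Gamma_const \<omega> a b = (MIN i. mean \<omega> (b i) * \<omega> / (inverse (sigma_comp \<omega> a i) - 1))"

definition chi_const ::
  "real \<Rightarrow> ('n::finite \<Rightarrow> real \<Rightarrow> real) \<Rightarrow> ('n \<Rightarrow> real \<Rightarrow> real) \<Rightarrow> real" where
  "chi_const \<omega> a b =
     (\<Sum>i\<in>UNIV. inverse (sigma_comp \<omega> a i) / (inverse (sigma_comp \<omega> a i) - 1)
                 * (mean \<omega> (b i) * \<omega>))"

text \<open>The filters for \<open>l1norm x\<close> tending to 0 and to infinity over the nonzero points of the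
  orthant; the origin is excluded by the right-sided neighbourhoods of 0.\<close>

definition orthant_at_0 :: "(real ^ 'n) filter" where
  "orthant_at_0 = inf (filtercomap l1norm (at_right 0)) (principal orthant)"

definition orthant_at_infinity :: "(real ^ 'n) filter" where
  "orthant_at_infinity = inf (filtercomap l1norm at_top) (principal orthant)"

definition is_lim_zero :: "(real ^ 'n \<Rightarrow> real) \<Rightarrow> ereal \<Rightarrow> bool" where
  "is_lim_zero g L \<longleftrightarrow> ((\<lambda>x. ereal (g x / l1norm x)) \<longlongrightarrow> L) orthant_at_0"

definition is_lim_infinity :: "(real ^ 'n \<Rightarrow> real) \<Rightarrow> ereal \<Rightarrow> bool" where
  "is_lim_infinity g L \<longleftrightarrow> ((\<lambda>x. ereal (g x / l1norm x)) \<longlongrightarrow> L) orthant_at_infinity"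

text \<open>Lists, so that two equal values are counted twice.\<close>

definition num_zeros :: "ereal \<Rightarrow> ereal \<Rightarrow> nat" where
  "num_zeros u v = length (filter (\<lambda>y. y = 0) [u, v])"

definition num_infinities :: "ereal \<Rightarrow> ereal \<Rightarrow> nat" where
  "num_infinities u v = length (filter (\<lambda>y. y = \<infinity>) [u, v])"

definition is_solution ::
  "('n \<Rightarrow> real \<Rightarrow> real) \<Rightarrow> ('n \<Rightarrow> real \<Rightarrow> real) \<Rightarrow> (real \<Rightarrow> real) \<Rightarrow>
   ('n \<Rightarrow> real ^ 'n \<Rightarrow> real) \<Rightarrow> real \<Rightarrow> (real \<Rightarrow> real ^ 'n) \<Rightarrow> bool" where
  "is_solution a b \<tau> f \<mu> x \<longleftrightarrow>
     (\<forall>i t. ((\<lambda>s. x s $ i) has_real_derivative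
               (- a i t * x t $ i + \<mu> * b i t * f i (x (t - \<tau> t)))) (at t))"

definition positive_function :: "(real \<Rightarrow> real ^ 'n) \<Rightarrow> bool" where
  "positive_function x \<longleftrightarrow> (\<forall>t i. 0 \<le> x t $ i) \<and> (\<exists>i. \<forall>t. 0 < x t $ i)"

end

theory Submission
  imports Defs "HOL-Complex_Analysis.Great_Picard"
begin

text \<open>
  Integrating the \<open>i\<close>-th equation with the factor \<open>exp (\<integral> a i)\<close> shows that for a nonnegative
  periodic forcing \<open>h\<close> the equation \<open>x' = - a i * x + h\<close> has a periodic solution, and that
  \<open>q \<le> (1 / \<sigma>\<^sub>i - 1) * x t \<le> q / \<sigma>\<^sub>i\<close> at all times, where \<open>q\<close> is the integral of \<open>h\<close> over a
  period and \<open>\<sigma>\<^sub>i = sigma_comp \<omega> a i\<close>. Periodic solutions of the delay system are therefore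
  the fixed points of the operator \<open>T\<close> that sends \<open>y\<close> to the periodic solution with forcing
  \<open>\<mu> * b i t * f i (y (t - \<tau> t))\<close>, and the values of \<open>T\<close> satisfy the Harnack inequality
  \<open>\<sigma> * y t $ i \<le> y u $ i\<close>. On the cone of such functions the sizes at different times are
  comparable.

  The bounds on \<open>x\<close> say that \<open>T\<close> expands where one component of \<open>f\<close> has slope
  \<open>f j x / l1norm x\<close> above \<open>1 / (\<mu> * \<sigma> * \<Gamma>)\<close> and contracts where all slopes are below
  \<open>1 / (\<mu> * \<chi>\<^sub>0)\<close>. The two inequalities for \<open>\<mu>\<close> thus state that \<open>T\<close> expands at one end of the
  cone (near zero or near infinity) and contracts at the other.

  If \<open>T\<close> expands near zero and contracts near infinity, a bounded, closed and equicontinuous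
  part of the cone is invariant and Schauder's theorem applies. A small constant \<open>\<epsilon>\<close> added to
  the forcing keeps the fixed points away from zero by a distance independent of \<open>\<epsilon>\<close>, and
  \<open>\<epsilon> \<rightarrow> 0\<close> gives a nonzero one (\<open>compression_fixed_point\<close>). In the opposite case the
  substitution \<open>x = y / c\<^sup>2\<close> with \<open>c = l1norm (y 0)\<close> exchanges the two ends and preserves
  slopes, which reduces it to the first one (\<open>positive_solution_steep_at_infinity\<close>).

  Schauder's theorem for compact convex sets is derived from Brouwer's theorem on cubes of
  arbitrary finite dimension, and the latter from Kuhn's combinatorial lemma.
\<close>

section \<open>The fixed-point theorems of Brouwer and Schauder\<close>

lemma tendsto_coordinatewise:
  fixes g :: "'b \<Rightarrow> 'i \<Rightarrow> 'c::topological_space"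
  assumes "\<And>i. ((\<lambda>x. g x i) \<longlongrightarrow> l i) F"
  shows "(g \<longlongrightarrow> l) F"
proof -
  have "limitin (product_topology (\<lambda>i. euclidean) UNIV) g l F"
    using assms by (simp add: limitin_componentwise)
  then show ?thesis
    by (simp add: euclidean_product_topology)
qed

text \<open>
  The cube of dimension \<open>m\<close> sits in the product space \<open>nat \<Rightarrow> real\<close>, with all coordinates from
  \<open>m\<close> on pinned to 0. All dimensions then live in one type, which Schauder's theorem needs:
  there the dimension is the size of a finite net.
\<close>

definition nat_cube :: "nat \<Rightarrow> (nat \<Rightarrow> real) set" where
  "nat_cube m = {u. \<forall>i. u i \<in> (if i < m then {0..1} else {0})}"

lemma nat_cube_bounds: "u \<in> nat_cube m \<Longrightarrow> i < m \<Longrightarrow> 0 \<le> u i \<and> u i \<le> 1"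
  unfolding nat_cube_def mem_Collect_eq by (metis atLeastAtMost_iff)

lemma nat_cube_zero: "u \<in> nat_cube m \<Longrightarrow> \<not> i < m \<Longrightarrow> u i = 0"
  unfolding nat_cube_def mem_Collect_eq by (metis singletonD)

lemma compact_nat_cube: "compact (nat_cube m)"
proof -
  have "compactin (product_topology (\<lambda>i. euclidean) UNIV)
          (\<Pi>\<^sub>E i\<in>UNIV. if i < m then {0..1} else {0::real})"
    by (simp add: compactin_PiE)
  moreover have "(\<Pi>\<^sub>E i\<in>UNIV. if i < m then {0..1} else {0}) = nat_cube m"
    by (auto simp: nat_cube_def PiE_def Pi_def)
  ultimately show ?thesis
    by (simp add: euclidean_product_topology)
qed

text \<open>
  Kuhn's combinatorial lemma on the grid of mesh \<open>1 / (k + 1)\<close> yields a point \<open>c k\<close> such that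
  every coordinate \<open>i\<close> is pushed up by \<open>F\<close> at one point close to \<open>c k\<close> and pushed down at
  another. At a cluster point of the sequence \<open>c\<close>, continuity makes both inequalities hold at
  once.
\<close>

lemma brouwer_nat_cube:
  fixes F :: "(nat \<Rightarrow> real) \<Rightarrow> nat \<Rightarrow> real"
  assumes cont: "continuous_on (nat_cube m) F" and maps: "F ` nat_cube m \<subseteq> nat_cube m"
  obtains u where "u \<in> nat_cube m" "F u = u"
proof -
  \<comment> \<open>The label records the direction in which \<open>F\<close> moves a coordinate: 0 for up, 1
    for down.\<close>
  have "\<exists>l. (\<forall>x i. l x i \<le> (1::nat)) \<and>
             (\<forall>x i. x \<in> nat_cube m \<and> i < m \<and> x i = 0 \<longrightarrow> l x i = 0) \<and>
             (\<forall>x i. x \<in> nat_cube m \<and> i < m \<and> x i = 1 \<longrightarrow> l x i = 1) \<and>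
             (\<forall>x i. x \<in> nat_cube m \<and> i < m \<and> l x i = 0 \<longrightarrow> x i \<le> F x i) \<and>
             (\<forall>x i. x \<in> nat_cube m \<and> i < m \<and> l x i = 1 \<longrightarrow> F x i \<le> x i)"
    using maps nat_cube_bounds by (intro kuhn_labelling_lemma') blast+
  then obtain l :: "(nat \<Rightarrow> real) \<Rightarrow> nat \<Rightarrow> nat" where
      l01: "l x i \<le> 1"
      and l0: "x \<in> nat_cube m \<Longrightarrow> i < m \<Longrightarrow> x i = 0 \<Longrightarrow> l x i = 0"
      and l1: "x \<in> nat_cube m \<Longrightarrow> i < m \<Longrightarrow> x i = 1 \<Longrightarrow> l x i = 1"
      and up: "x \<in> nat_cube m \<Longrightarrow> i < m \<Longrightarrow> l x i = 0 \<Longrightarrow> x i \<le> F x i"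
      and down: "x \<in> nat_cube m \<Longrightarrow> i < m \<Longrightarrow> l x i = 1 \<Longrightarrow> F x i \<le> x i" for x i
    by blast
  have "\<exists>c\<in>nat_cube m. \<forall>i<m. \<exists>r\<in>nat_cube m. \<exists>s\<in>nat_cube m.
          (\<forall>j. \<bar>r j - c j\<bar> \<le> 1 / real (Suc k) \<and> \<bar>s j - c j\<bar> \<le> 1 / real (Suc k))
          \<and> r i \<le> F r i \<and> F s i \<le> s i" for k
  proof -
    define p where "p = Suc k"
    define pt where "pt x = (\<lambda>i. if i < m then real (x i) / real p else 0)" for x :: "nat \<Rightarrow> nat"
    have p: "0 < p" by (simp add: p_def)
    have pt: "pt x \<in> nat_cube m" if "\<forall>i<m. x i \<le> p" for x
      using that p by (auto simp: pt_def nat_cube_def)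
    obtain q where q: "\<forall>i<m. q i < p"
      and rs: "\<forall>i<m. \<exists>r s. (\<forall>j<m. q j \<le> r j \<and> r j \<le> q j + 1) \<and>
                 (\<forall>j<m. q j \<le> s j \<and> s j \<le> q j + 1) \<and> l (pt r) i \<noteq> l (pt s) i"
    proof (rule kuhn_lemma[OF p, where n = m and label = "\<lambda>x. l (pt x)"])
      show "\<forall>x. (\<forall>i<m. x i \<le> p) \<longrightarrow> (\<forall>i<m. l (pt x) i = 0 \<or> l (pt x) i = 1)"
        using l01 by (metis le_less less_one)
      show "\<forall>x. (\<forall>i<m. x i \<le> p) \<longrightarrow> (\<forall>i<m. x i = 0 \<longrightarrow> l (pt x) i = 0)"
        using l0 pt by (simp add: pt_def)
      show "\<forall>x. (\<forall>i<m. x i \<le> p) \<longrightarrow> (\<forall>i<m. x i = p \<longrightarrow> l (pt x) i = 1)"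
        using l1 pt p by (simp add: pt_def)
    qed blast
    have "\<exists>r\<in>nat_cube m. \<exists>s\<in>nat_cube m.
          (\<forall>j. \<bar>r j - pt q j\<bar> \<le> 1 / real p \<and> \<bar>s j - pt q j\<bar> \<le> 1 / real p)
          \<and> r i \<le> F r i \<and> F s i \<le> s i" if i: "i < m" for i
    proof -
      obtain r s where r: "\<forall>j<m. q j \<le> r j \<and> r j \<le> q j + 1"
        and s: "\<forall>j<m. q j \<le> s j \<and> s j \<le> q j + 1" and ne: "l (pt r) i \<noteq> l (pt s) i"
        using rs i by blast
      have near: "\<bar>pt x j - pt q j\<bar> \<le> 1 / real p"
        if "\<forall>j<m. q j \<le> x j \<and> x j \<le> q j + 1" for x j
      proof (cases "j < m")
        case True
        then have "\<bar>real (x j) - real (q j)\<bar> \<le> 1" using that by force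
        then show ?thesis using True p
          by (simp add: pt_def diff_divide_distrib[symmetric] divide_right_mono)
      qed (simp add: pt_def)
      have cube: "pt x \<in> nat_cube m" if "\<forall>j<m. q j \<le> x j \<and> x j \<le> q j + 1" for x
        using that q by (intro pt) (metis Suc_eq_plus1 Suc_leI le_trans)
      consider "l (pt r) i = 0" "l (pt s) i = 1" | "l (pt s) i = 0" "l (pt r) i = 1"
        using ne l01[of "pt r" i] l01[of "pt s" i] by linarith
      then show ?thesis
        by cases (metis cube up down near i r s)+
    qed
    moreover have "pt q \<in> nat_cube m" using q by (intro pt) auto
    ultimately show ?thesis unfolding p_def by blast
  qed
  then obtain c where c: "\<And>k. c k \<in> nat_cube m"
    and approx: "\<And>k i. i < m \<Longrightarrow> \<exists>r\<in>nat_cube m. \<exists>s\<in>nat_cube m.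
          (\<forall>j. \<bar>r j - c k j\<bar> \<le> 1 / real (Suc k) \<and> \<bar>s j - c k j\<bar> \<le> 1 / real (Suc k))
          \<and> r i \<le> F r i \<and> F s i \<le> s i"
    by metis
  obtain u \<rho> where u: "u \<in> nat_cube m" and \<rho>: "strict_mono \<rho>" and lim: "(c \<circ> \<rho>) \<longlonglongrightarrow> u"
    using compact_imp_seq_compact[OF compact_nat_cube[of m]] c unfolding seq_compact_def by meson
  have limc: "(\<lambda>k. c (\<rho> k) j) \<longlonglongrightarrow> u j" for j
    using continuous_on_tendsto_compose[OF continuous_on_product_coordinates[of j] lim] by simp
  have lim0: "(\<lambda>k. 1 / real (Suc (\<rho> k))) \<longlonglongrightarrow> 0"
    using LIMSEQ_subseq_LIMSEQ[OF lim_1_over_n[THEN LIMSEQ_Suc] \<rho>] by (simp add: o_def)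
  have follow: "v \<longlonglongrightarrow> u"
    if "\<And>k j. \<bar>v k j - c (\<rho> k) j\<bar> \<le> 1 / real (Suc (\<rho> k))" for v :: "nat \<Rightarrow> nat \<Rightarrow> real"
  proof (rule tendsto_coordinatewise)
    fix j
    have "(\<lambda>k. v k j - c (\<rho> k) j) \<longlonglongrightarrow> 0"
      by (rule Lim_null_comparison[OF _ lim0]) (use that in simp)
    from tendsto_add[OF this limc[of j]] show "(\<lambda>k. v k j) \<longlonglongrightarrow> u j" by simp
  qed
  have Flim: "(\<lambda>k. F (v k) i) \<longlonglongrightarrow> F u i"
    if "v \<longlonglongrightarrow> u" "\<And>k. v k \<in> nat_cube m" for v i
    using continuous_on_tendsto_compose[OF continuous_on_product_coordinates[of i]
        continuous_on_tendsto_compose[OF cont that(1) u]] that(2) by simp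
  have vlim: "(\<lambda>k. v k i) \<longlonglongrightarrow> u i" if "v \<longlonglongrightarrow> u" for v :: "nat \<Rightarrow> nat \<Rightarrow> real" and i
    using continuous_on_tendsto_compose[OF continuous_on_product_coordinates[of i] that] by simp
  have "F u i = u i" for i
  proof (cases "i < m")
    case True
    then have "\<forall>k. \<exists>r s. r \<in> nat_cube m \<and> s \<in> nat_cube m \<and>
          (\<forall>j. \<bar>r j - c (\<rho> k) j\<bar> \<le> 1 / real (Suc (\<rho> k)) \<and> \<bar>s j - c (\<rho> k) j\<bar> \<le> 1 / real (Suc (\<rho> k)))
          \<and> r i \<le> F r i \<and> F s i \<le> s i"
      using approx by blast
    then obtain r s where rs: "\<And>k. r k \<in> nat_cube m" "\<And>k. s k \<in> nat_cube m"
      and near: "\<And>k j. \<bar>r k j - c (\<rho> k) j\<bar> \<le> 1 / real (Suc (\<rho> k))"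
        "\<And>k j. \<bar>s k j - c (\<rho> k) j\<bar> \<le> 1 / real (Suc (\<rho> k))"
      and le: "\<And>k. r k i \<le> F (r k) i" "\<And>k. F (s k) i \<le> s k i"
      by metis
    have r: "r \<longlonglongrightarrow> u" and s: "s \<longlonglongrightarrow> u" using near by (auto intro: follow)
    show ?thesis
      using LIMSEQ_le[OF vlim[OF r] Flim[OF r rs(1)]] LIMSEQ_le[OF Flim[OF s rs(2)] vlim[OF s]] le
      by (meson antisym)
  next
    case False
    moreover have "F u \<in> nat_cube m" using u maps by blast
    ultimately show ?thesis using u nat_cube_zero by metis
  qed
  then show ?thesis using u that by blast
qed

text \<open>
  The Schauder projection onto the hull of a finite \<open>e\<close>-net moves points by at most \<open>e\<close>.
  Composed with \<open>f\<close> it factors through a finite-dimensional cube of weights, where Brouwer's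
  theorem applies; this gives points that \<open>f\<close> moves by at most \<open>e\<close>, and compactness turns them
  into a fixed point.
\<close>

proposition schauder_fixed_point:
  fixes S :: "'a::real_normed_vector set"
  assumes "compact S" "convex S" "S \<noteq> {}"
    and cont: "continuous_on S f" and maps: "f ` S \<subseteq> S"
  obtains x where "x \<in> S" "f x = x"
proof -
  have near_fixed: "\<exists>x\<in>S. norm (f x - x) \<le> e" if e: "e > 0" for e :: real
  proof -
    obtain N where N: "finite N" "N \<subseteq> S" "S \<subseteq> (\<Union>x\<in>N. ball x e)"
      using compactE_image[OF \<open>compact S\<close>, of S "\<lambda>x. ball x e"] e by force
    obtain m and p :: "nat \<Rightarrow> 'a" where p: "p ` {..<m} = N"
      using finite_imp_nat_seg_image_inj_on[OF N(1)] by (metis lessThan_def)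
    have pS: "p j \<in> S" if "j < m" for j using p N(2) that by blast
    have "N \<noteq> {}" using N(3) \<open>S \<noteq> {}\<close> by blast
    then have m: "0 < m" using p by (cases m) auto
    define w where "w x j = max 0 (e - norm (x - p j))" for x j
    define W where "W x = (\<Sum>j<m. w x j)" for x
    define B where "B x j = (if j < m then w x j / W x else 0)" for x j
    \<comment> \<open>Weights of total mass below 1 get the missing mass on \<open>p 0\<close>, so that the
      normalization in \<open>A\<close> is defined and continuous on the whole cube, including the origin.\<close>
    define r where "r u = max 0 (1 - (\<Sum>j<m. u j))" for u :: "nat \<Rightarrow> real"
    define A where "A u = inverse ((\<Sum>j<m. u j) + r u) *\<^sub>R ((\<Sum>j<m. u j *\<^sub>R p j) + r u *\<^sub>R p 0)"
      for u :: "nat \<Rightarrow> real"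
    have w0: "0 \<le> w x j" for x j by (simp add: w_def)
    have W: "0 < W x" if x: "x \<in> S" for x
    proof -
      obtain y where "y \<in> N" "norm (x - y) < e"
        using subsetD[OF N(3) x] by (auto simp: dist_norm norm_minus_commute)
      then obtain j where "j < m" "norm (x - p j) < e"
        using p by auto
      then show ?thesis unfolding W_def
        by (intro sum_pos2[of _ j]) (auto simp: w_def)
    qed
    have B1: "(\<Sum>j<m. B x j) = 1" if "x \<in> S" for x
      using W[OF that] by (simp add: B_def sum_divide_distrib[symmetric] W_def[symmetric])
    have B0: "0 \<le> B x j" if "x \<in> S" for x j
      using W[OF that] w0 by (simp add: B_def)
    have Bcube: "B x \<in> nat_cube m" if "x \<in> S" for x
    proof -
      have "B x j \<le> 1" if j: "j < m" for j
        using member_le_sum[of j "{..<m}" "B x"] B0 B1 \<open>x \<in> S\<close> j by auto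
      moreover have "B x j = 0" if "\<not> j < m" for j using that by (simp add: B_def)
      ultimately show ?thesis using B0[OF that] by (auto simp: nat_cube_def)
    qed
    have Apos: "0 < (\<Sum>j<m. u j) + r u" for u by (simp add: r_def)
    have AS: "A u \<in> S" if u: "u \<in> nat_cube m" for u
    proof -
      define c where "c j = inverse ((\<Sum>j<m. u j) + r u) * (u j + (if j = 0 then r u else 0))" for j
      have u0: "0 \<le> u j" if "j < m" for j using nat_cube_bounds[OF u that] by simp
      have s: "(\<Sum>j<m. (u j + (if j = 0 then r u else 0))) = (\<Sum>j<m. u j) + r u"
        using m by (simp add: sum.distrib)
      have "(\<Sum>j<m. c j) = 1"
        unfolding c_def sum_distrib_left[symmetric] s using Apos[of u] by simp
      moreover have "0 \<le> c j" if "j < m" for j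
        using Apos[of u] u0[OF that] by (auto simp: c_def r_def intro!: mult_nonneg_nonneg)
      ultimately have "(\<Sum>j<m. c j *\<^sub>R p j) \<in> S"
        using pS \<open>convex S\<close> by (intro convex_sum) auto
      also have "(\<Sum>j<m. c j *\<^sub>R p j) = A u"
      proof -
        have "(\<Sum>j<m. (if j = 0 then r u else 0) *\<^sub>R p j) = r u *\<^sub>R p 0"
          using m by (simp add: if_distrib[where f="\<lambda>c. c *\<^sub>R _"] cong: if_cong)
        then show ?thesis
          by (simp add: A_def c_def scaleR_sum_right[symmetric] scaleR_scaleR[symmetric]
              scaleR_add_left sum.distrib del: scaleR_scaleR)
      qed
      finally show ?thesis .
    qed
    have contA: "continuous_on (nat_cube m) A"
    proof -
      have co: "continuous_on (nat_cube m) (\<lambda>u. u j)" for j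
        by (rule continuous_on_product_coordinates[THEN continuous_on_subset]) simp
      show ?thesis
        unfolding A_def r_def
        by (intro continuous_intros co) (use Apos in \<open>force simp: r_def\<close>)
    qed
    have contB: "continuous_on S B"
      unfolding B_def W_def w_def
    proof (intro continuous_on_coordinatewise_then_product)
      fix j
      show "continuous_on S (\<lambda>x. if j < m
         then max 0 (e - norm (x - p j)) / (\<Sum>j<m. max 0 (e - norm (x - p j))) else 0)"
        by (cases "j < m"; simp; intro continuous_intros)
          (use W in \<open>force simp: W_def w_def\<close>)
    qed
    have "continuous_on (nat_cube m) (\<lambda>u. B (f (A u)))"
      using AS maps
      by (intro continuous_on_compose2[OF contB] continuous_on_compose2[OF cont] contA) auto
    moreover have "(\<lambda>u. B (f (A u))) ` nat_cube m \<subseteq> nat_cube m"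
      using Bcube AS maps by blast
    ultimately obtain u where u: "u \<in> nat_cube m" "B (f (A u)) = u"
      by (rule brouwer_nat_cube)
    define y where "y = f (A u)"
    have y: "y \<in> S" using AS[OF u(1)] maps by (auto simp: y_def)
    have uB: "u = B y" using u(2) by (simp add: y_def)
    have u1: "(\<Sum>j<m. u j) = 1" using B1[OF y] uB by simp
    then have Au: "A u = (\<Sum>j<m. u j *\<^sub>R p j)" by (simp add: A_def r_def)
    have "y - A u = (\<Sum>j<m. u j *\<^sub>R (y - p j))"
      using u1 by (simp add: Au scaleR_diff_right sum_subtractf scaleR_sum_left[symmetric])
    also have "norm \<dots> \<le> (\<Sum>j<m. u j * e)"
    proof (rule sum_norm_le)
      fix j assume j: "j \<in> {..<m}"
      have "norm (y - p j) \<le> e" if "u j \<noteq> 0"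
        using that by (auto simp: uB B_def w_def split: if_splits)
      moreover have "0 \<le> u j" using uB B0[OF y] by simp
      ultimately show "norm (u j *\<^sub>R (y - p j)) \<le> u j * e"
        by (cases "u j = 0") (auto intro: mult_left_mono)
    qed
    also have "\<dots> = e" using u1 by (simp add: sum_distrib_right[symmetric])
    finally show ?thesis using AS[OF u(1)] by (auto simp: y_def)
  qed
  have "\<forall>k. \<exists>x. x \<in> S \<and> norm (f x - x) \<le> 1 / real (Suc k)"
    using near_fixed by (metis divide_pos_pos of_nat_0_less_iff zero_less_Suc zero_less_one)
  then obtain x where x: "\<And>k. x k \<in> S" "\<And>k. norm (f (x k) - x k) \<le> 1 / real (Suc k)"
    by metis
  obtain z \<rho> where z: "z \<in> S" and \<rho>: "strict_mono \<rho>" and lim: "(x \<circ> \<rho>) \<longlonglongrightarrow> z"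
    using \<open>compact S\<close> x(1) unfolding compact_eq_seq_compact_metric seq_compact_def by meson
  have lim0: "(\<lambda>k. 1 / real (Suc (\<rho> k))) \<longlonglongrightarrow> 0"
    using LIMSEQ_subseq_LIMSEQ[OF lim_1_over_n[THEN LIMSEQ_Suc] \<rho>] by (simp add: o_def)
  have "(\<lambda>k. f (x (\<rho> k)) - x (\<rho> k)) \<longlonglongrightarrow> 0"
    by (rule Lim_null_comparison[OF _ lim0]) (use x(2) in simp)
  moreover have "(\<lambda>k. f (x (\<rho> k)) - x (\<rho> k)) \<longlonglongrightarrow> f z - z"
    using lim continuous_on_tendsto_compose[OF cont lim z] x(1)
    by (intro tendsto_diff) (auto simp: o_def)
  ultimately have "f z = z" using LIMSEQ_unique by fastforce
  then show ?thesis using z that by blast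
qed

section \<open>Periodic solutions of a scalar linear equation\<close>

lemma antiderivative_exists:
  fixes h :: "real \<Rightarrow> real"
  assumes "continuous_on UNIV h"
  shows "\<exists>F. \<forall>t. (F has_real_derivative h t) (at t)"
proof -
  have "\<exists>F. \<forall>t::real. -\<infinity> < ereal t \<longrightarrow> ereal t < \<infinity> \<longrightarrow> (F has_vector_derivative h t) (at t)"
    using assms by (intro einterval_antiderivative) (auto simp: continuous_on_eq_continuous_at)
  then show ?thesis by (auto simp: has_real_derivative_iff_has_vector_derivative)
qed

text \<open>
  Used with \<open>k = 1\<close> for periodic integrands and with the growth factor \<open>k\<close> of the integrating
  factor over one period.
\<close>

lemma antiderivative_increment:
  fixes F h :: "real \<Rightarrow> real"
  assumes "\<And>t. (F has_real_derivative h t) (at t)" "\<And>t. h (t + \<omega>) = k * h t"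
  shows "F (t + \<omega>) - k * F t = F \<omega> - k * F 0"
proof -
  have "((\<lambda>t. F (t + \<omega>) - k * F t) has_real_derivative 0) (at t)" for t
    by (rule derivative_eq_intros DERIV_chain2[OF assms(1)] assms(1) refl)+ (simp add: assms(2))
  then have "F (t + \<omega>) - k * F t = F (0 + \<omega>) - k * F 0"
    by (intro DERIV_isconst_all) blast
  then show ?thesis by simp
qed

lemma mean_eq_increment:
  assumes "\<omega> > 0" "\<And>t. (F has_real_derivative h t) (at t)"
  shows "mean \<omega> h * \<omega> = F \<omega> - F 0"
proof -
  have "(h has_integral F \<omega> - F 0) {0..\<omega>}"
    using assms by (intro fundamental_theorem_of_calculus)
      (auto simp: has_real_derivative_iff_has_vector_derivative[symmetric] intro: has_field_derivative_at_within)
  then show ?thesis using \<open>\<omega> > 0\<close> by (simp add: mean_def integral_unique)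
qed

lemma mean_mono:
  assumes "\<omega> > 0" "continuous_on UNIV g" "continuous_on UNIV h" "\<And>t. g t \<le> h t"
  shows "mean \<omega> g * \<omega> \<le> mean \<omega> h * \<omega>"
proof -
  have "integral {0..\<omega>} g \<le> integral {0..\<omega>} h"
    using assms by (intro integral_le integrable_continuous_real) (auto intro: continuous_on_subset)
  then show ?thesis using \<open>\<omega> > 0\<close> by (simp add: mean_def)
qed

lemma mean_const: "\<omega> > 0 \<Longrightarrow> mean \<omega> (\<lambda>_. c) = c"
  by (simp add: mean_def)

lemma mean_cmult: "mean \<omega> (\<lambda>t. c * h t) = c * mean \<omega> h"
  by (simp add: mean_def)

text \<open>
  With antiderivatives \<open>A\<close> of \<open>a\<close> and \<open>H\<close> of \<open>exp A * h\<close>, and \<open>k\<close> the factor by which \<open>exp A\<close>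
  grows over a period, the periodic solution is \<open>exp (- A t) * (H (t + \<omega>) - H t) / (k - 1)\<close>,
  that is, the integral of \<open>h\<close> against the periodic Green function.
\<close>

lemma periodic_forced_exists:
  assumes "\<omega> > 0"
    and a: "continuous_on UNIV a" "\<And>t. a (t + \<omega>) = a t" "mean \<omega> a > 0"
    and h: "continuous_on UNIV h" "\<And>t. h (t + \<omega>) = h t"
  obtains x where "\<And>t. x (t + \<omega>) = x t"
    "\<And>t. (x has_real_derivative - a t * x t + h t) (at t)"
proof -
  obtain A where A: "\<And>t. (A has_real_derivative a t) (at t)"
    using antiderivative_exists[OF a(1)] by blast
  have Acont: "continuous_on UNIV A"
    using A by (auto simp: continuous_on_eq_continuous_at intro: DERIV_isCont)
  define k where "k = exp (mean \<omega> a * \<omega>)"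
  have k: "k > 1" using a(3) \<open>\<omega> > 0\<close> by (simp add: k_def)
  have Ak: "exp (A (t + \<omega>)) = k * exp (A t)" for t
    using antiderivative_increment[OF A, of \<omega> 1 t] a(2) mean_eq_increment[OF \<open>\<omega> > 0\<close> A]
    by (simp add: k_def exp_add[symmetric]) 
  obtain H where H: "\<And>t. (H has_real_derivative exp (A t) * h t) (at t)"
    using antiderivative_exists[of "\<lambda>t. exp (A t) * h t"]
      continuous_on_mult[OF continuous_on_exp[OF Acont] h(1)] by blast
  define x where "x t = exp (- A t) * (H (t + \<omega>) - H t) / (k - 1)" for t
  have Hinc: "H (t + \<omega> + \<omega>) - H (t + \<omega>) = k * (H (t + \<omega>) - H t)" for t
    using antiderivative_increment[OF H, of \<omega> k t] antiderivative_increment[OF H, of \<omega> k "t + \<omega>"]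
    by (simp add: Ak h(2) algebra_simps)
  have "x (t + \<omega>) = x t" for t
  proof -
    have "exp (- A (t + \<omega>)) * k = exp (- A t)"
      using k by (simp add: exp_minus Ak)
    then have "exp (- A (t + \<omega>)) * (k * (H (t + \<omega>) - H t)) = exp (- A t) * (H (t + \<omega>) - H t)"
      by (metis mult.assoc)
    then show ?thesis unfolding x_def Hinc by simp
  qed
  moreover have "(x has_real_derivative - a t * x t + h t) (at t)" for t
  proof -
    have "(x has_real_derivative
        (exp (- A t) * (exp (A (t + \<omega>)) * h (t + \<omega>) - exp (A t) * h t)
         + exp (- A t) * (- a t) * (H (t + \<omega>) - H t)) / (k - 1)) (at t)"
      unfolding x_def
      by (rule DERIV_cdivide)
        (auto intro!: derivative_eq_intros DERIV_chain2[OF H] H A simp: algebra_simps)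
    also have "(exp (- A t) * (exp (A (t + \<omega>)) * h (t + \<omega>) - exp (A t) * h t)
         + exp (- A t) * (- a t) * (H (t + \<omega>) - H t)) / (k - 1)
        = h t - a t * x t"
    proof -
      have "exp (- A t) * (exp (A (t + \<omega>)) * h (t + \<omega>) - exp (A t) * h t) = (k - 1) * h t"
        unfolding Ak h(2) by (simp add: exp_minus field_simps)
      then show ?thesis using k by (simp add: diff_divide_distrib x_def)
    qed
    finally show ?thesis by simp
  qed
  ultimately show ?thesis using that by blast
qed

text \<open>
  The function \<open>exp A * x\<close> has derivative \<open>exp A * h\<close>. Over the period from \<open>t\<close> to \<open>t + \<omega>\<close> it
  grows by \<open>exp (A t) * (exp (mean \<omega> a * \<omega>) - 1) * x t\<close>, and since \<open>A\<close> is nondecreasing the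
  factor \<open>exp A\<close> in the derivative lies between its values at the two ends.
\<close>

lemma periodic_forced_bounds:
  assumes "\<omega> > 0"
    and a: "continuous_on UNIV a" "\<And>t. a (t + \<omega>) = a t" "\<And>t. 0 \<le> a t"
    and h: "continuous_on UNIV h" "\<And>t. h (t + \<omega>) = h t" "\<And>t. 0 \<le> h t"
    and x: "\<And>t. x (t + \<omega>) = x t" "\<And>t. (x has_real_derivative - a t * x t + h t) (at t)"
  shows "mean \<omega> h * \<omega> \<le> (exp (mean \<omega> a * \<omega>) - 1) * x t"
    and "(exp (mean \<omega> a * \<omega>) - 1) * x t \<le> exp (mean \<omega> a * \<omega>) * (mean \<omega> h * \<omega>)"
proof -
  obtain A where A: "\<And>t. (A has_real_derivative a t) (at t)"
    using antiderivative_exists[OF a(1)] by blast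
  obtain Q where Q: "\<And>t. (Q has_real_derivative h t) (at t)"
    using antiderivative_exists[OF h(1)] by blast
  define k where "k = exp (mean \<omega> a * \<omega>)"
  define q where "q = mean \<omega> h * \<omega>"
  have Ak: "exp (A (t + \<omega>)) = k * exp (A t)"
    using antiderivative_increment[OF A, of \<omega> 1 t] a(2) mean_eq_increment[OF \<open>\<omega> > 0\<close> A]
    by (simp add: k_def exp_add[symmetric])
  have Qq: "Q (t + \<omega>) - Q t = q"
    using antiderivative_increment[OF Q, of \<omega> 1 t] h(2) mean_eq_increment[OF \<open>\<omega> > 0\<close> Q]
    by (simp add: q_def)
  have Amono: "exp (A u) \<le> exp (A v)" if "u \<le> v" for u v
    using DERIV_nonneg_imp_nondecreasing[OF that, of A] A a(3) by auto
  have G: "((\<lambda>r. exp (A r) * x r) has_real_derivative exp (A r) * h r) (at r)" for r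
    using DERIV_mult[OF DERIV_fun_exp[OF A] x(2)] by (simp add: algebra_simps)
  have "exp (A t) * x t - exp (A t) * Q t
      \<le> exp (A (t + \<omega>)) * x (t + \<omega>) - exp (A t) * Q (t + \<omega>)"
  proof (rule DERIV_nonneg_imp_nondecreasing[where f = "\<lambda>r. exp (A r) * x r - exp (A t) * Q r"])
    fix r assume "t \<le> r" "r \<le> t + \<omega>"
    have "((\<lambda>r. exp (A r) * x r - exp (A t) * Q r) has_real_derivative
           (exp (A r) - exp (A t)) * h r) (at r)"
      using DERIV_diff[OF G[of r] DERIV_cmult[OF Q[of r], of "exp (A t)"]]
      by (simp only: left_diff_distrib)
    moreover have "0 \<le> (exp (A r) - exp (A t)) * h r"
      using Amono[OF \<open>t \<le> r\<close>] h(3) by simp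
    ultimately show "\<exists>y. ((\<lambda>r. exp (A r) * x r - exp (A t) * Q r) has_real_derivative y) (at r) \<and> 0 \<le> y"
      by blast
  qed (use \<open>\<omega> > 0\<close> in simp)
  then have "exp (A t) * q \<le> exp (A t) * ((k - 1) * x t)"
    unfolding Ak x(1) Qq[symmetric] by (simp add: algebra_simps)
  then show "mean \<omega> h * \<omega> \<le> (exp (mean \<omega> a * \<omega>) - 1) * x t"
    by (simp add: q_def k_def)
  have "exp (A (t + \<omega>)) * Q t - exp (A t) * x t
      \<le> exp (A (t + \<omega>)) * Q (t + \<omega>) - exp (A (t + \<omega>)) * x (t + \<omega>)"
  proof (rule DERIV_nonneg_imp_nondecreasing[where f = "\<lambda>r. exp (A (t + \<omega>)) * Q r - exp (A r) * x r"])
    fix r assume "t \<le> r" "r \<le> t + \<omega>"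
    have "((\<lambda>r. exp (A (t + \<omega>)) * Q r - exp (A r) * x r) has_real_derivative
           (exp (A (t + \<omega>)) - exp (A r)) * h r) (at r)"
      using DERIV_diff[OF DERIV_cmult[OF Q[of r], of "exp (A (t + \<omega>))"] G[of r]]
      by (simp only: left_diff_distrib)
    moreover have "0 \<le> (exp (A (t + \<omega>)) - exp (A r)) * h r"
      using Amono[OF \<open>r \<le> t + \<omega>\<close>] h(3) by simp
    ultimately show "\<exists>y. ((\<lambda>r. exp (A (t + \<omega>)) * Q r - exp (A r) * x r) has_real_derivative y) (at r) \<and> 0 \<le> y"
      by blast
  qed (use \<open>\<omega> > 0\<close> in simp)
  then have "exp (A t) * ((k - 1) * x t) \<le> exp (A t) * (k * q)"
    unfolding Ak x(1) Qq[symmetric] by (simp add: algebra_simps)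
  then show "(exp (mean \<omega> a * \<omega>) - 1) * x t \<le> exp (mean \<omega> a * \<omega>) * (mean \<omega> h * \<omega>)"
    by (simp add: q_def k_def)
qed

text \<open>
  Comparison with the periodic solution \<open>y\<close> for the constant forcing \<open>\<delta>\<close>: both \<open>y + x\<close> and
  \<open>y - x\<close> solve the equation with a nonnegative forcing and are therefore nonnegative.
\<close>

lemma periodic_forced_abs_bound:
  assumes "\<omega> > 0"
    and a: "continuous_on UNIV a" "\<And>t. a (t + \<omega>) = a t" "\<And>t. 0 \<le> a t" "mean \<omega> a > 0"
    and h: "continuous_on UNIV h" "\<And>t. h (t + \<omega>) = h t" "\<And>t. \<bar>h t\<bar> \<le> \<delta>"
    and x: "\<And>t. x (t + \<omega>) = x t" "\<And>t. (x has_real_derivative - a t * x t + h t) (at t)"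
  shows "\<bar>x t\<bar> \<le> exp (mean \<omega> a * \<omega>) * \<omega> / (exp (mean \<omega> a * \<omega>) - 1) * \<delta>"
proof -
  define k where "k = exp (mean \<omega> a * \<omega>)"
  have k: "k > 1" using a(4) \<open>\<omega> > 0\<close> by (simp add: k_def)
  have \<delta>: "0 \<le> \<delta>" using h(3)[of 0] by simp
  obtain y where y: "\<And>t. y (t + \<omega>) = y t" "\<And>t. (y has_real_derivative - a t * y t + \<delta>) (at t)"
    by (rule periodic_forced_exists[OF \<open>\<omega> > 0\<close> a(1,2,4), of "\<lambda>_. \<delta>"]) (auto)
  have pos: "0 \<le> y t + c * x t" if c: "c = 1 \<or> c = -1" for c
  proof -
    have "mean \<omega> (\<lambda>t. \<delta> + c * h t) * \<omega> \<le> (k - 1) * (y t + c * x t)"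
      unfolding k_def
    proof (rule periodic_forced_bounds(1)[OF \<open>\<omega> > 0\<close> a(1-3), where x = "\<lambda>t. y t + c * x t"])
      show "0 \<le> \<delta> + c * h t" for t using h(3)[of t] c by auto
      show "((\<lambda>t. y t + c * x t) has_real_derivative - a t * (y t + c * x t) + (\<delta> + c * h t)) (at t)" for t
        by (auto intro!: derivative_eq_intros x(2) y(2) simp: algebra_simps)
    qed (auto intro!: continuous_intros h(1) simp: h(2) x(1) y(1))
    moreover have "0 \<le> mean \<omega> (\<lambda>t. \<delta> + c * h t) * \<omega>"
    proof -
      have "mean \<omega> (\<lambda>_. 0) * \<omega> \<le> mean \<omega> (\<lambda>t. \<delta> + c * h t) * \<omega>"
      proof (rule mean_mono[OF \<open>\<omega> > 0\<close>])
        show "0 \<le> \<delta> + c * h t" for t using h(3)[of t] c by auto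
      qed (auto intro!: continuous_intros h(1))
      then show ?thesis by (simp add: mean_const[OF \<open>\<omega> > 0\<close>])
    qed
    ultimately have "0 \<le> (k - 1) * (y t + c * x t)" by linarith
    then show ?thesis using k by (simp add: zero_le_mult_iff)
  qed
  have "(k - 1) * y t \<le> k * (mean \<omega> (\<lambda>_. \<delta>) * \<omega>)"
    unfolding k_def by (rule periodic_forced_bounds(2)[OF \<open>\<omega> > 0\<close> a(1-3) _ _ _ y]) (auto simp: \<delta>)
  then have "y t \<le> k * \<omega> / (k - 1) * \<delta>"
    using k by (simp add: mean_const[OF \<open>\<omega> > 0\<close>] field_simps)
  then show ?thesis using pos[of 1] pos[of "-1"] by (simp add: k_def)
qed

section \<open>The uncoupled system with prescribed forcing\<close>

lemma sigma_comp_exp: "exp (mean \<omega> (a i) * \<omega>) = inverse (sigma_comp \<omega> a i)"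
  by (simp add: sigma_comp_def exp_minus)

text \<open>
  The point \<open>s\<close> does not depend on the function, so that two periodic functions can be
  compared at \<open>t\<close> through their values at the same \<open>s\<close>.
\<close>

lemma periodic_representative:
  fixes \<omega> :: real
  assumes "\<omega> > 0"
  shows "\<exists>s\<in>{0..\<omega>}. \<forall>h :: real \<Rightarrow> 'b. (\<forall>t. h (t + \<omega>) = h t) \<longrightarrow> h t = h s"
proof
  show "t - real_of_int \<lfloor>t / \<omega>\<rfloor> * \<omega> \<in> {0..\<omega>}"
    using floor_divide_lower[OF assms, of t] floor_divide_upper[OF assms, of t]
    by (simp add: algebra_simps)
  show "\<forall>h :: real \<Rightarrow> 'b. (\<forall>t. h (t + \<omega>) = h t) \<longrightarrow> h t = h (t - real_of_int \<lfloor>t / \<omega>\<rfloor> * \<omega>)"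
  proof (intro allI impI)
    fix h :: "real \<Rightarrow> 'b" assume "\<forall>t. h (t + \<omega>) = h t"
    then interpret periodic_fun_simple h \<omega> by unfold_locales simp
    show "h t = h (t - real_of_int \<lfloor>t / \<omega>\<rfloor> * \<omega>)" by (simp add: minus_of_int)
  qed
qed

lemma periodic_family_bounded:
  fixes h :: "'n::finite \<Rightarrow> real \<Rightarrow> real"
  assumes "\<omega> > 0" "\<And>i. continuous_on UNIV (h i)" "\<And>i t. h i (t + \<omega>) = h i t"
  shows "\<exists>B\<ge>0. \<forall>i t. \<bar>h i t\<bar> \<le> B"
proof -
  have "\<exists>B. \<forall>t. \<bar>h i t\<bar> \<le> B" for i
  proof -
    have "bounded (h i ` {0..\<omega>})"
      by (intro compact_imp_bounded compact_continuous_image continuous_on_subset[OF assms(2)]) auto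
    then obtain B where B: "\<forall>t\<in>{0..\<omega>}. \<bar>h i t\<bar> \<le> B" by (auto simp: bounded_iff)
    have "\<bar>h i t\<bar> \<le> B" for t
    proof -
      obtain s where "s \<in> {0..\<omega>}" "h i t = h i s"
        using periodic_representative[OF assms(1), of t] assms(3) by blast
      then show ?thesis using B by simp
    qed
    then show ?thesis by blast
  qed
  then obtain B where B: "\<And>i t. \<bar>h i t\<bar> \<le> B i" by metis
  have B0: "0 \<le> B i" for i using B[of i 0] by simp
  have "\<bar>h i t\<bar> \<le> (\<Sum>i\<in>UNIV. B i)" for i t
    using B[of i t] member_le_sum[of i UNIV B] B0 by simp
  then show ?thesis using B0 by (intro exI[of _ "\<Sum>i\<in>UNIV. B i"]) (simp add: sum_nonneg)
qed

lemma l1norm_orthant: "v \<in> orthant \<Longrightarrow> l1norm v = (\<Sum>i\<in>UNIV. v $ i)"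
  by (simp add: l1norm_def orthant_def)

lemma l1norm_nonneg: "0 \<le> l1norm v"
  by (simp add: l1norm_def sum_nonneg)

lemma component_le_l1norm: "\<bar>v $ i\<bar> \<le> l1norm v"
  unfolding l1norm_def by (intro member_le_sum) auto

lemma norm_le_l1norm: "norm v \<le> l1norm v"
  unfolding l1norm_def by (rule norm_le_l1_cart)

lemma l1norm_eq_0: "l1norm v = 0 \<longleftrightarrow> v = 0"
  using norm_le_l1norm[of v] by (auto simp: l1norm_def)

lemma l1norm_scaleR: "l1norm (c *\<^sub>R v) = \<bar>c\<bar> * l1norm v"
  by (simp add: l1norm_def abs_mult sum_distrib_left)

lemma continuous_on_l1norm [continuous_intros]:
  "continuous_on S h \<Longrightarrow> continuous_on S (\<lambda>x. l1norm (h x))"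
  unfolding l1norm_def by (intro continuous_intros)

lemma closed_orthant: "closed orthant"
  unfolding orthant_def
  by (intro closed_Collect_all closed_Collect_le continuous_intros)

locale periodic_coefficients =
  fixes \<omega> :: real and a b :: "'n::finite \<Rightarrow> real \<Rightarrow> real"
  assumes period_pos: "\<omega> > 0"
    and a_cont: "\<And>i. continuous_on UNIV (a i)" and a_nonneg: "\<And>i t. 0 \<le> a i t"
    and a_periodic: "\<And>i t. a i (t + \<omega>) = a i t" and a_mean: "\<And>i. mean \<omega> (a i) > 0"
    and b_cont: "\<And>i. continuous_on UNIV (b i)" and b_nonneg: "\<And>i t. 0 \<le> b i t"
    and b_periodic: "\<And>i t. b i (t + \<omega>) = b i t" and b_mean: "\<And>i. mean \<omega> (b i) > 0"
begin

abbreviation \<sigma> where "\<sigma> \<equiv> sigma_min \<omega> a"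
abbreviation \<Gamma> where "\<Gamma> \<equiv> Gamma_const \<omega> a b"
abbreviation \<chi>\<^sub>0 where "\<chi>\<^sub>0 \<equiv> chi_const \<omega> a b"

lemma sigma_comp_bounds: "0 < sigma_comp \<omega> a i" "sigma_comp \<omega> a i < 1"
  using period_pos a_mean[of i] by (simp_all add: sigma_comp_def)

lemma inverse_sigma_gt: "1 < inverse (sigma_comp \<omega> a i)"
  using sigma_comp_bounds[of i] by (simp add: one_less_inverse)

lemma sigma_le: "\<sigma> \<le> sigma_comp \<omega> a i"
  by (simp add: sigma_min_def)

lemma sigma_bounds: "0 < \<sigma>" "\<sigma> \<le> 1"
proof -
  have "\<sigma> \<in> range (sigma_comp \<omega> a)"
    unfolding sigma_min_def by (rule Min_in) auto
  then obtain i where "\<sigma> = sigma_comp \<omega> a i" by blast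
  then show "0 < \<sigma>" "\<sigma> \<le> 1" using sigma_comp_bounds[of i] by simp_all
qed

lemma Gamma_le: "\<Gamma> \<le> mean \<omega> (b i) * \<omega> / (inverse (sigma_comp \<omega> a i) - 1)"
  by (simp add: Gamma_const_def)

lemma Gamma_pos: "0 < \<Gamma>"
proof -
  have "\<Gamma> \<in> range (\<lambda>i. mean \<omega> (b i) * \<omega> / (inverse (sigma_comp \<omega> a i) - 1))"
    unfolding Gamma_const_def by (rule Min_in) auto
  then show ?thesis using b_mean period_pos inverse_sigma_gt by auto
qed

lemma chi_pos: "0 < \<chi>\<^sub>0"
  unfolding chi_const_def
  by (intro sum_pos mult_pos_pos divide_pos_pos)
    (use b_mean period_pos inverse_sigma_gt sigma_comp_bounds in auto)

end

locale periodic_system = periodic_coefficients \<omega> a b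
  for \<omega> :: real and a b :: "'n::finite \<Rightarrow> real \<Rightarrow> real" +
  fixes \<mu> :: real
  assumes \<mu>_pos: "\<mu> > 0"
begin

text \<open>
  The coupled delay equation is the case in which \<open>g\<close> is computed from \<open>z\<close> itself; keeping \<open>g\<close>
  separate exhibits periodic solutions as fixed points of the map that sends a function to the
  periodic solution forced by it.
\<close>

definition forced_solution :: "('n \<Rightarrow> real \<Rightarrow> real) \<Rightarrow> (real \<Rightarrow> real ^ 'n) \<Rightarrow> bool" where
  "forced_solution g z \<longleftrightarrow> (\<forall>t. z (t + \<omega>) = z t) \<and>
     (\<forall>i t. ((\<lambda>s. z s $ i) has_real_derivative - a i t * z t $ i + \<mu> * b i t * g i t) (at t))"

definition admissible :: "('n \<Rightarrow> real \<Rightarrow> real) \<Rightarrow> bool" where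
  "admissible g \<longleftrightarrow> (\<forall>i. continuous_on UNIV (g i)) \<and> (\<forall>i t. g i (t + \<omega>) = g i t)"

lemma forced_solution_periodic: "forced_solution g z \<Longrightarrow> z (t + \<omega>) = z t"
  by (simp add: forced_solution_def)

lemma forced_solution_DERIV:
  "forced_solution g z \<Longrightarrow>
    ((\<lambda>s. z s $ i) has_real_derivative - a i t * z t $ i + \<mu> * b i t * g i t) (at t)"
  by (simp add: forced_solution_def)

lemma forced_solution_continuous:
  assumes "forced_solution g z"
  shows "continuous_on UNIV z"
proof -
  have "continuous_on UNIV (\<lambda>t. z t $ i)" for i
    using DERIV_isCont[OF forced_solution_DERIV[OF assms]]
    by (simp add: continuous_on_eq_continuous_at)
  then have "continuous_on UNIV (\<lambda>t. \<chi> i. z t $ i)" by (intro continuous_on_vec_lambda)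
  then show ?thesis by simp
qed

lemma forcing_cont: "admissible g \<Longrightarrow> continuous_on UNIV (\<lambda>t. \<mu> * b i t * g i t)"
  by (auto simp: admissible_def intro!: continuous_intros b_cont)

lemma forcing_periodic: "admissible g \<Longrightarrow> \<mu> * b i (t + \<omega>) * g i (t + \<omega>) = \<mu> * b i t * g i t"
  by (simp add: admissible_def b_periodic)

lemma forced_solution_exists:
  assumes "admissible g"
  shows "\<exists>z. forced_solution g z"
proof -
  have "\<exists>x. (\<forall>t. x (t + \<omega>) = x t) \<and>
      (\<forall>t. (x has_real_derivative - a i t * x t + \<mu> * b i t * g i t) (at t))" for i
    by (rule periodic_forced_exists[OF period_pos a_cont a_periodic a_mean
          forcing_cont[OF assms] forcing_periodic[OF assms]]) blast
  then obtain x where x: "\<And>i t. x i (t + \<omega>) = x i t"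
      "\<And>i t. (x i has_real_derivative - a i t * x i t + \<mu> * b i t * g i t) (at t)"
    by metis
  then have "forced_solution g (\<lambda>t. \<chi> i. x i t)"
    by (simp add: forced_solution_def)
  then show ?thesis by blast
qed

lemma forced_solution_sandwich:
  assumes "admissible g" "forced_solution g z" "\<And>t. 0 \<le> g i t"
  defines "q \<equiv> mean \<omega> (\<lambda>t. \<mu> * b i t * g i t) * \<omega> / (inverse (sigma_comp \<omega> a i) - 1)"
  shows "q \<le> z t $ i" "z t $ i \<le> inverse (sigma_comp \<omega> a i) * q"
proof -
  have nn: "0 \<le> \<mu> * b i t * g i t" for t
    using assms(3) \<mu>_pos b_nonneg by simp
  have per: "z (t + \<omega>) $ i = z t $ i" for t
    by (simp add: forced_solution_periodic[OF assms(2)])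
  note B = periodic_forced_bounds[OF period_pos a_cont a_periodic a_nonneg
      forcing_cont[OF assms(1)] forcing_periodic[OF assms(1)] nn per
      forced_solution_DERIV[OF assms(2)], of t]
  show "q \<le> z t $ i" "z t $ i \<le> inverse (sigma_comp \<omega> a i) * q"
    using B[unfolded sigma_comp_exp] inverse_sigma_gt[of i]
    by (simp_all add: q_def pos_divide_le_eq pos_le_divide_eq mult.commute)
qed

lemma mean_forcing_mono:
  assumes "continuous_on UNIV h" "continuous_on UNIV h'" "\<And>t. h t \<le> h' t"
  shows "mean \<omega> (\<lambda>t. \<mu> * b i t * h t) * \<omega> \<le> mean \<omega> (\<lambda>t. \<mu> * b i t * h' t) * \<omega>"
  using assms \<mu>_pos b_nonneg
  by (intro mean_mono period_pos mult_left_mono continuous_intros b_cont) auto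

lemma mean_forcing_const: "mean \<omega> (\<lambda>t. \<mu> * b i t * m) = \<mu> * m * mean \<omega> (b i)"
  using mean_cmult[of \<omega> "\<mu> * m" "b i"] by (simp add: mult_ac)

lemma forced_solution_nonneg:
  assumes "admissible g" "forced_solution g z" "\<And>t. 0 \<le> g i t"
  shows "0 \<le> z t $ i"
proof -
  have "0 \<le> mean \<omega> (\<lambda>t. \<mu> * b i t * g i t) * \<omega>"
    using mean_forcing_mono[of "\<lambda>_. 0" "g i" i] assms
    by (simp add: admissible_def mean_const[OF period_pos])
  then show ?thesis
    using forced_solution_sandwich(1)[OF assms] inverse_sigma_gt[of i]
    by (meson diff_gt_0_iff_gt divide_nonneg_pos order_trans)
qed

text \<open>
  The two bounds of the sandwich differ by the factor \<open>inverse (sigma_comp \<omega> a i)\<close>, whatever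
  the forcing. All values of the operator therefore lie in one cone, on which the sizes of a
  function at different times are comparable.
\<close>

lemma forced_solution_harnack:
  assumes "admissible g" "forced_solution g z" "\<And>t. 0 \<le> g i t"
  shows "\<sigma> * z t $ i \<le> z u $ i"
proof -
  have "\<sigma> * z t $ i \<le> sigma_comp \<omega> a i * z t $ i"
    using forced_solution_nonneg[OF assms] sigma_le by (intro mult_right_mono) auto
  also have "\<dots> \<le> z u $ i"
  proof -
    define q where "q = mean \<omega> (\<lambda>t. \<mu> * b i t * g i t) * \<omega> / (inverse (sigma_comp \<omega> a i) - 1)"
    have "z t $ i \<le> inverse (sigma_comp \<omega> a i) * q"
      unfolding q_def by (rule forced_solution_sandwich(2)[OF assms])
    then have "sigma_comp \<omega> a i * z t $ i \<le> q"
      using sigma_comp_bounds[of i] by (simp add: field_simps)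
    also have "q \<le> z u $ i"
      unfolding q_def by (rule forced_solution_sandwich(1)[OF assms])
    finally show ?thesis .
  qed
  finally show ?thesis .
qed

text \<open>
  Expansion: a single large component of the forcing makes the solution large, with constant
  \<open>\<Gamma>\<close>.
\<close>

lemma forced_solution_lower:
  assumes "admissible g" "forced_solution g z" "\<And>t. m \<le> g i t" "0 \<le> m"
  shows "\<mu> * \<Gamma> * m \<le> z t $ i"
proof -
  have "\<mu> * \<Gamma> * m \<le> \<mu> * (mean \<omega> (b i) * \<omega> / (inverse (sigma_comp \<omega> a i) - 1)) * m"
    using \<mu>_pos assms(4) Gamma_le by (intro mult_right_mono mult_left_mono) auto
  also have "\<dots> = mean \<omega> (\<lambda>t. \<mu> * b i t * m) * \<omega> / (inverse (sigma_comp \<omega> a i) - 1)"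
    by (simp add: mean_forcing_const)
  also have "\<dots> \<le> mean \<omega> (\<lambda>t. \<mu> * b i t * g i t) * \<omega> / (inverse (sigma_comp \<omega> a i) - 1)"
    using assms(1,3) inverse_sigma_gt[of i]
    by (intro divide_right_mono mean_forcing_mono) (auto simp: admissible_def)
  also have "\<dots> \<le> z t $ i"
    using assms(3,4) by (intro forced_solution_sandwich[OF assms(1,2)]) (meson order_trans)
  finally show ?thesis .
qed

text \<open>
  Contraction: \<open>\<chi>\<^sub>0\<close> sums the upper constants because the size of a vector is the sum of its
  components.
\<close>

lemma forced_solution_upper:
  assumes "admissible g" "forced_solution g z" "\<And>i t. 0 \<le> g i t" "\<And>i t. g i t \<le> M"
  shows "(\<Sum>i\<in>UNIV. z t $ i) \<le> \<mu> * \<chi>\<^sub>0 * M"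
proof -
  have "z t $ i \<le> \<mu> * M *
      (inverse (sigma_comp \<omega> a i) / (inverse (sigma_comp \<omega> a i) - 1) * (mean \<omega> (b i) * \<omega>))" for i
  proof -
    have "z t $ i \<le> inverse (sigma_comp \<omega> a i) *
        (mean \<omega> (\<lambda>t. \<mu> * b i t * g i t) * \<omega> / (inverse (sigma_comp \<omega> a i) - 1))"
      by (intro forced_solution_sandwich assms)
    also have "\<dots> \<le> inverse (sigma_comp \<omega> a i) *
        (mean \<omega> (\<lambda>t. \<mu> * b i t * M) * \<omega> / (inverse (sigma_comp \<omega> a i) - 1))"
      using assms(1,4) inverse_sigma_gt[of i] sigma_comp_bounds[of i]
      by (intro mult_left_mono divide_right_mono mean_forcing_mono) (auto simp: admissible_def)
    finally show ?thesis unfolding mean_forcing_const by (simp add: mult_ac)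
  qed
  then have "(\<Sum>i\<in>UNIV. z t $ i) \<le> (\<Sum>i\<in>UNIV. \<mu> * M *
      (inverse (sigma_comp \<omega> a i) / (inverse (sigma_comp \<omega> a i) - 1) * (mean \<omega> (b i) * \<omega>)))"
    by (intro sum_mono)
  also have "\<dots> = \<mu> * \<chi>\<^sub>0 * M" by (simp add: chi_const_def sum_distrib_left mult_ac)
  finally show ?thesis .
qed

text \<open>
  This makes the solution operator continuous for the supremum norm; with equal forcings it is
  the uniqueness of the periodic solution.
\<close>

lemma forced_solution_stable:
  "\<exists>K>0. \<forall>g g' z z' \<delta> t. admissible g \<longrightarrow> admissible g' \<longrightarrow> forced_solution g z \<longrightarrow> forced_solution g' z' \<longrightarrow>
      (\<forall>i t. \<bar>g i t - g' i t\<bar> \<le> \<delta>) \<longrightarrow> norm (z t - z' t) \<le> K * \<delta>"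
proof -
  obtain B where B: "0 \<le> B" "\<And>i t. \<bar>b i t\<bar> \<le> B"
    using periodic_family_bounded[of \<omega> b, OF period_pos b_cont b_periodic] by blast
  define k where "k i = exp (mean \<omega> (a i) * \<omega>)" for i
  define K where "K = (\<Sum>i\<in>UNIV. k i * \<omega> / (k i - 1) * (\<mu> * B))"
  have k: "1 < k i" for i using a_mean[of i] period_pos by (simp add: k_def)
  have K: "0 \<le> K" unfolding K_def
    by (intro sum_nonneg mult_nonneg_nonneg divide_nonneg_nonneg)
      (use k period_pos \<mu>_pos B in \<open>auto simp: k_def less_imp_le\<close>)
  have bound: "norm (z t - z' t) \<le> (K + 1) * \<delta>"
    if g: "admissible g" "admissible g'" and z: "forced_solution g z" "forced_solution g' z'"
      and \<delta>: "\<forall>i t. \<bar>g i t - g' i t\<bar> \<le> \<delta>" for g g' z z' \<delta> t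
  proof -
    have \<delta>0: "0 \<le> \<delta>" using \<delta> abs_ge_zero order_trans by blast
    have "\<bar>z t $ i - z' t $ i\<bar> \<le> k i * \<omega> / (k i - 1) * (\<mu> * B * \<delta>)" for i
      unfolding k_def
    proof (rule periodic_forced_abs_bound[OF period_pos a_cont a_periodic a_nonneg a_mean,
        where h = "\<lambda>t. \<mu> * b i t * (g i t - g' i t)" and x = "\<lambda>t. z t $ i - z' t $ i"])
      show "continuous_on UNIV (\<lambda>t. \<mu> * b i t * (g i t - g' i t))"
        using g by (auto simp: admissible_def intro!: continuous_intros b_cont)
      show "\<bar>\<mu> * b i t * (g i t - g' i t)\<bar> \<le> \<mu> * B * \<delta>" for t
        unfolding abs_mult using B \<delta> \<mu>_pos by (intro mult_mono) auto
      show "((\<lambda>t. z t $ i - z' t $ i) has_real_derivative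
              - a i t * (z t $ i - z' t $ i) + \<mu> * b i t * (g i t - g' i t)) (at t)" for t
        using DERIV_diff[OF forced_solution_DERIV[OF z(1)] forced_solution_DERIV[OF z(2)]]
        by (simp add: algebra_simps)
    qed (use g z in \<open>simp_all add: forcing_periodic admissible_def b_periodic forced_solution_periodic\<close>)
    then have "(\<Sum>i\<in>UNIV. \<bar>(z t - z' t) $ i\<bar>) \<le> (\<Sum>i\<in>UNIV. k i * \<omega> / (k i - 1) * (\<mu> * B * \<delta>))"
      by (intro sum_mono) simp
    also have "\<dots> = K * \<delta>"
      unfolding K_def sum_distrib_right by (intro sum.cong) simp_all
    finally show ?thesis using norm_le_l1_cart[of "z t - z' t"] \<delta>0 by (simp add: algebra_simps)
  qed
  show ?thesis
    by (rule exI[of _ "K + 1"]) (use bound K in auto)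
qed

text \<open>
  The common Lipschitz constant supplies the equicontinuity in the compactness argument.
\<close>

lemma forced_solution_lipschitz:
  "\<exists>A\<ge>0. \<forall>g z M R i t u. forced_solution g z \<longrightarrow> (\<forall>t. \<bar>z t $ i\<bar> \<le> R) \<longrightarrow> (\<forall>t. \<bar>g i t\<bar> \<le> M) \<longrightarrow>
      \<bar>z t $ i - z u $ i\<bar> \<le> A * (R + M) * \<bar>t - u\<bar>"
proof -
  obtain A where A: "0 \<le> A" "\<And>i t. \<bar>a i t\<bar> \<le> A"
    using periodic_family_bounded[of \<omega> a, OF period_pos a_cont a_periodic] by blast
  obtain B where B: "0 \<le> B" "\<And>i t. \<bar>b i t\<bar> \<le> B"
    using periodic_family_bounded[of \<omega> b, OF period_pos b_cont b_periodic] by blast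
  have "\<bar>z t $ i - z u $ i\<bar> \<le> (A + \<mu> * B) * (R + M) * \<bar>t - u\<bar>"
    if z: "forced_solution g z" and R: "\<forall>t. \<bar>z t $ i\<bar> \<le> R" and M: "\<forall>t. \<bar>g i t\<bar> \<le> M"
    for g z M R i t u
  proof -
    have nn: "0 \<le> R" "0 \<le> M" using R M abs_ge_zero order_trans by blast+
    have "norm (z t $ i - z u $ i) \<le> (A + \<mu> * B) * (R + M) * norm (t - u)"
    proof (rule field_differentiable_bound[where S = UNIV])
      fix s
      show "((\<lambda>s. z s $ i) has_field_derivative - a i s * z s $ i + \<mu> * b i s * g i s) (at s within UNIV)"
        using forced_solution_DERIV[OF z] by simp
      have "\<bar>- a i s * z s $ i + \<mu> * b i s * g i s\<bar> \<le> \<bar>a i s\<bar> * \<bar>z s $ i\<bar> + \<mu> * \<bar>b i s\<bar> * \<bar>g i s\<bar>"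
        using abs_triangle_ineq[of "- a i s * z s $ i" "\<mu> * b i s * g i s"] \<mu>_pos
        by (simp add: abs_mult)
      also have "\<dots> \<le> A * R + \<mu> * B * M"
        using A B R M \<mu>_pos by (intro add_mono mult_mono) auto
      also have "\<dots> \<le> (A + \<mu> * B) * (R + M)"
        using A(1) B(1) \<mu>_pos nn by (simp add: algebra_simps)
      finally show "norm (- a i s * z s $ i + \<mu> * b i s * g i s) \<le> (A + \<mu> * B) * (R + M)" by simp
    qed auto
    then show ?thesis by simp
  qed
  then show ?thesis using A(1) B(1) \<mu>_pos by (intro exI[of _ "A + \<mu> * B"]) auto
qed

end

section \<open>A compact convex set of periodic functions\<close>

lemma continuous_on_eval_bcontfun:
  "continuous_on S (\<lambda>y :: 'a::topological_space \<Rightarrow>\<^sub>C 'b::metric_space. apply_bcontfun y t)"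
  unfolding continuous_on_iff using dist_fun_lt_imp_dist_val_lt by blast

text \<open>
  The set on which Schauder's theorem is applied. The third condition is the Harnack
  inequality satisfied by all periodic solutions with nonnegative forcing; the last one gives
  compactness. The size is bounded by the plain sum of the components, which is linear in \<open>y\<close>
  and agrees with \<open>l1norm\<close> on the orthant.
\<close>

definition periodic_cone :: "real \<Rightarrow> real \<Rightarrow> real \<Rightarrow> real \<Rightarrow> (real \<Rightarrow>\<^sub>C (real ^ 'n)) set" where
  "periodic_cone \<omega> \<sigma> R L = {y :: real \<Rightarrow>\<^sub>C (real ^ 'n). (\<forall>t. y (t + \<omega>) = y t) \<and> (\<forall>t i. 0 \<le> y t $ i) \<and>
     (\<forall>t u i. \<sigma> * y t $ i \<le> y u $ i) \<and> (\<forall>t. (\<Sum>i\<in>UNIV. y t $ i) \<le> R) \<and>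
     (\<forall>t u i. \<bar>y t $ i - y u $ i\<bar> \<le> L * \<bar>t - u\<bar>)}"

lemma periodic_cone_orthant: "y \<in> periodic_cone \<omega> \<sigma> R L \<Longrightarrow> apply_bcontfun y t \<in> orthant"
  by (simp add: periodic_cone_def orthant_def)

lemma periodic_cone_l1norm_le: "y \<in> periodic_cone \<omega> \<sigma> R L \<Longrightarrow> l1norm (apply_bcontfun y t) \<le> R"
  using l1norm_orthant[OF periodic_cone_orthant[of y \<omega> \<sigma> R L t]] by (simp add: periodic_cone_def)

lemma convex_periodic_cone: "convex (periodic_cone \<omega> \<sigma> R L)"
proof (rule convexI)
  fix x y :: "real \<Rightarrow>\<^sub>C (real ^ 'n)" and u v :: real
  assume x: "x \<in> periodic_cone \<omega> \<sigma> R L" and y: "y \<in> periodic_cone \<omega> \<sigma> R L"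
    and uv: "0 \<le> u" "0 \<le> v" "u + v = 1"
  have ap: "apply_bcontfun (u *\<^sub>R x + v *\<^sub>R y) t = u *\<^sub>R x t + v *\<^sub>R y t" for t
    by (simp add: plus_bcontfun.rep_eq scaleR_bcontfun.rep_eq)
  have comb: "u * p + v * q \<le> u * p' + v * q'" if "p \<le> p'" "q \<le> q'" for p q p' q' :: real
    using that uv by (intro add_mono mult_left_mono)
  have "\<sigma> * (u * x t $ i + v * y t $ i) \<le> u * x s $ i + v * y s $ i" for t s i
    using comb[of "\<sigma> * x t $ i" "x s $ i" "\<sigma> * y t $ i" "y s $ i"] x y
    by (simp add: periodic_cone_def algebra_simps)
  moreover have "(\<Sum>i\<in>UNIV. u * x t $ i + v * y t $ i) \<le> R" for t
    using comb[of "\<Sum>i\<in>UNIV. x t $ i" R "\<Sum>i\<in>UNIV. y t $ i" R] x y uv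
    by (simp add: periodic_cone_def sum.distrib sum_distrib_left[symmetric] distrib_right[symmetric])
  moreover have "\<bar>u * x t $ i + v * y t $ i - (u * x s $ i + v * y s $ i)\<bar> \<le> L * \<bar>t - s\<bar>" for t s i
  proof -
    have "\<bar>u * x t $ i + v * y t $ i - (u * x s $ i + v * y s $ i)\<bar>
        = \<bar>u * (x t $ i - x s $ i) + v * (y t $ i - y s $ i)\<bar>"
      by (simp add: algebra_simps)
    also have "\<dots> \<le> u * \<bar>x t $ i - x s $ i\<bar> + v * \<bar>y t $ i - y s $ i\<bar>"
      using abs_triangle_ineq[of "u * (x t $ i - x s $ i)" "v * (y t $ i - y s $ i)"] uv
      by (simp add: abs_mult)
    also have "\<dots> \<le> u * (L * \<bar>t - s\<bar>) + v * (L * \<bar>t - s\<bar>)"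
      using x y by (intro comb) (simp_all add: periodic_cone_def)
    also have "\<dots> = L * \<bar>t - s\<bar>" using uv by (simp add: distrib_right[symmetric])
    finally show ?thesis .
  qed
  ultimately show "u *\<^sub>R x + v *\<^sub>R y \<in> periodic_cone \<omega> \<sigma> R L"
    using x y uv by (simp add: periodic_cone_def ap)
qed

text \<open>
  The theorem of Arzela and Ascoli applies on one period; periodicity turns uniform
  convergence there into convergence in the supremum norm over the whole line.
\<close>

lemma compact_periodic_cone:
  assumes "\<omega> > 0" "0 \<le> L"
  shows "compact (periodic_cone \<omega> \<sigma> R L :: (real \<Rightarrow>\<^sub>C (real ^ 'n::finite)) set)"
  unfolding compact_eq_seq_compact_metric seq_compact_def
proof (intro allI impI)
  let ?S = "periodic_cone \<omega> \<sigma> R L :: (real \<Rightarrow>\<^sub>C (real ^ 'n)) set"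
  fix Y :: "nat \<Rightarrow> real \<Rightarrow>\<^sub>C (real ^ 'n)" assume Y: "\<forall>n. Y n \<in> ?S"
  define C where "C = real CARD('n) * L + 1"
  have C: "0 < C" using assms by (simp add: C_def add_nonneg_pos)
  have lip: "norm (Y n t - Y n u) \<le> C * \<bar>t - u\<bar>" for n t u
  proof -
    have "norm (Y n t - Y n u) \<le> (\<Sum>i\<in>UNIV. \<bar>(Y n t - Y n u) $ i\<bar>)" by (rule norm_le_l1_cart)
    also have "\<dots> \<le> (\<Sum>i\<in>(UNIV::'n set). L * \<bar>t - u\<bar>)"
      using Y by (intro sum_mono) (simp add: periodic_cone_def)
    also have "\<dots> \<le> C * \<bar>t - u\<bar>" by (simp add: C_def algebra_simps)
    finally show ?thesis .
  qed
  obtain g k where k: "strict_mono (k :: nat \<Rightarrow> nat)"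
    and unif: "\<And>e. 0 < e \<Longrightarrow> \<exists>N. \<forall>n t. n \<ge> N \<and> t \<in> {0..\<omega>} \<longrightarrow> norm (Y (k n) t - g t) < e"
  proof (rule Arzela_Ascoli[of "{0..\<omega>}" "\<lambda>n. apply_bcontfun (Y n)" R])
    show "norm (Y n t) \<le> R" for n t
      using norm_le_l1norm periodic_cone_l1norm_le Y order_trans by blast
    show "\<exists>d>0. \<forall>n u. u \<in> {0..\<omega>} \<and> norm (t - u) < d \<longrightarrow> norm (Y n t - Y n u) < e"
      if "0 < e" for t e
    proof (intro exI[of _ "e / C"] conjI allI impI)
      fix n u assume "u \<in> {0..\<omega>} \<and> norm (t - u) < e / C"
      then have "C * \<bar>t - u\<bar> < e" using C by (simp add: pos_less_divide_eq mult.commute)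
      then show "norm (Y n t - Y n u) < e" using lip[of n t u] by linarith
    qed (use that C in simp)
  qed auto
  have "Cauchy (Y \<circ> k)"
  proof (rule metric_CauchyI)
    fix e :: real assume "0 < e"
    then obtain N where N: "\<And>n t. n \<ge> N \<Longrightarrow> t \<in> {0..\<omega>} \<Longrightarrow> norm (Y (k n) t - g t) < e / 3"
      using unif[of "e / 3"] by auto
    have "dist (Y (k m)) (Y (k n)) \<le> 2 * e / 3" if "m \<ge> N" "n \<ge> N" for m n
    proof (rule dist_bound)
      fix t
      obtain s where s: "s \<in> {0..\<omega>}" "Y (k m) t = Y (k m) s" "Y (k n) t = Y (k n) s"
      proof -
        have "Y (k m) (u + \<omega>) = Y (k m) u" "Y (k n) (u + \<omega>) = Y (k n) u" for u
          using Y by (simp_all add: periodic_cone_def)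
        then show ?thesis using periodic_representative[OF assms(1), of t] that by blast
      qed
      have "norm (Y (k m) s - Y (k n) s) \<le> norm (Y (k m) s - g s) + norm (Y (k n) s - g s)"
        by (metis norm_triangle_ineq4 diff_diff_eq2 diff_add_cancel)
      then show "dist (Y (k m) t) (Y (k n) t) \<le> 2 * e / 3"
        using N[OF that(1) s(1)] N[OF that(2) s(1)] by (simp add: s(2,3) dist_norm)
    qed
    then show "\<exists>M. \<forall>m\<ge>M. \<forall>n\<ge>M. dist ((Y \<circ> k) m) ((Y \<circ> k) n) < e"
      using \<open>0 < e\<close> by (intro exI[of _ N]) (fastforce simp: o_def)
  qed
  then obtain l where l: "(Y \<circ> k) \<longlonglongrightarrow> l"
    using Cauchy_convergent_iff convergent_def by blast
  have "closed ?S"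
    unfolding periodic_cone_def
    by (intro closed_Collect_conj closed_Collect_all closed_Collect_le closed_Collect_eq
        continuous_intros continuous_on_eval_bcontfun)
  then have "l \<in> ?S"
    using l Y closed_sequentially by (metis comp_apply)
  then show "\<exists>l\<in>?S. \<exists>r. strict_mono r \<and> (Y \<circ> r) \<longlonglongrightarrow> l"
    using k l by blast
qed

section \<open>Fixed points by compression of the cone\<close>

context periodic_system
begin

text \<open>
  Contains the pairs \<open>(l1norm (y 0), y u)\<close> for all functions \<open>y\<close> in the cone. The nonlinearity
  below takes the size of \<open>y\<close> at time 0 as an additional argument, because the rescaling in
  the case of steep growth at infinity depends on it; the value at a fixed time replaces the
  supremum norm, which is comparable to it by the Harnack inequality.
\<close>

definition harnack_region :: "(real \<times> (real ^ 'n)) set" where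
  "harnack_region = {p. (\<forall>i. 0 \<le> snd p $ i) \<and>
     \<sigma> * fst p \<le> l1norm (snd p) \<and> \<sigma> * l1norm (snd p) \<le> fst p}"

lemma compact_harnack_region: "compact (harnack_region \<inter> {p. l1norm (snd p) \<le> R})"
proof -
  have "closed (harnack_region \<inter> {p. l1norm (snd p) \<le> R})"
    unfolding harnack_region_def Int_Collect[symmetric]
    by (intro closed_Int closed_Collect_conj closed_Collect_all closed_Collect_le continuous_intros)
  moreover have "bounded (harnack_region \<inter> {p. l1norm (snd p) \<le> R})"
  proof -
    have "norm p \<le> R / \<sigma> + R" if p: "p \<in> harnack_region" "l1norm (snd p) \<le> R" for p
    proof -
      have "0 \<le> \<sigma> * l1norm (snd p)" using sigma_bounds l1norm_nonneg[of "snd p"] by simp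
      then have "0 \<le> fst p" using p by (simp add: harnack_region_def)
      moreover have "fst p \<le> R / \<sigma>"
        using p sigma_bounds by (simp add: harnack_region_def pos_le_divide_eq mult.commute)
      moreover have "norm (snd p) \<le> R" using norm_le_l1norm p(2) order_trans by blast
      ultimately show ?thesis using norm_Pair_le[of "fst p" "snd p"] by simp
    qed
    then show ?thesis unfolding bounded_iff by blast
  qed
  ultimately show ?thesis by (simp add: compact_eq_bounded_closed)
qed

lemma l1norm_harnack:
  fixes v w :: "real ^ 'n"
  assumes "v \<in> orthant" "w \<in> orthant" "\<And>i. \<sigma> * v $ i \<le> w $ i"
  shows "\<sigma> * l1norm v \<le> l1norm w"
  unfolding l1norm_orthant[OF assms(1)] l1norm_orthant[OF assms(2)] sum_distrib_left
  by (intro sum_mono assms)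

lemma periodic_cone_region:
  assumes "y \<in> periodic_cone \<omega> \<sigma> R L"
  shows "(l1norm (y 0), y u) \<in> harnack_region"
  using assms l1norm_harnack periodic_cone_orthant[OF assms]
  by (simp add: harnack_region_def periodic_cone_def)

text \<open>
  The bound \<open>Hup\<close> with \<open>\<mu> * \<chi>\<^sub>0 * \<theta> < 1\<close> makes a large piece \<open>S\<close> of the cone invariant under
  the operator, so Schauder's theorem gives fixed points; the difficulty is that the zero
  function may be one of them. Adding a constant \<open>\<epsilon> > 0\<close> to the forcing removes it: by \<open>Hlow\<close>
  a fixed point \<open>y\<close> with \<open>l1norm (y 0) \<le> r\<close> would satisfy
  \<open>l1norm (y 0) \<ge> \<mu> * \<Gamma> * (\<eta> * (\<sigma> * l1norm (y 0)) + \<epsilon>)\<close>, which exceeds \<open>l1norm (y 0)\<close>. Since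
  \<open>r\<close> does not depend on \<open>\<epsilon>\<close>, the bound survives the limit \<open>\<epsilon> \<rightarrow> 0\<close>.
\<close>

proposition compression_fixed_point:
  fixes H :: "'n \<Rightarrow> real \<times> (real ^ 'n) \<Rightarrow> real"
  assumes \<tau>: "continuous_on UNIV \<tau>" "\<And>t. \<tau> (t + \<omega>) = \<tau> t"
    and Hcont: "\<And>i. continuous_on harnack_region (H i)"
    and Hnn: "\<And>i p. p \<in> harnack_region \<Longrightarrow> 0 \<le> H i p"
    and Hup: "\<And>i p. p \<in> harnack_region \<Longrightarrow> H i p \<le> C + \<theta> * l1norm (snd p)"
    and C: "0 \<le> C" and \<theta>: "0 \<le> \<theta>" "\<mu> * \<chi>\<^sub>0 * \<theta> < 1"
    and Hlow: "\<And>p. p \<in> harnack_region \<Longrightarrow> fst p \<le> r \<Longrightarrow> \<eta> * l1norm (snd p) \<le> H j p"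
    and r: "0 < r" and \<eta>: "0 \<le> \<eta>" "1 \<le> \<mu> * \<Gamma> * (\<sigma> * \<eta>)"
  shows "\<exists>y. forced_solution (\<lambda>i t. H i (l1norm (y 0), y (t - \<tau> t))) y \<and> (\<forall>t i. 0 \<le> y t $ i) \<and>
    (\<forall>t u i. \<sigma> * y t $ i \<le> y u $ i) \<and> 0 < l1norm (y 0)"
proof -
  obtain A where A: "0 \<le> A" and lip: "\<And>g z M R i t u. forced_solution g z \<Longrightarrow> (\<forall>t. \<bar>z t $ i\<bar> \<le> R) \<Longrightarrow>
      (\<forall>t. \<bar>g i t\<bar> \<le> M) \<Longrightarrow> \<bar>z t $ i - z u $ i\<bar> \<le> A * (R + M) * \<bar>t - u\<bar>"
    using forced_solution_lipschitz by blast
  obtain K where K: "0 < K" and stable: "\<And>g g' z z' \<delta> t. admissible g \<Longrightarrow> admissible g' \<Longrightarrow>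
      forced_solution g z \<Longrightarrow> forced_solution g' z' \<Longrightarrow>
      (\<forall>i t. \<bar>g i t - g' i t\<bar> \<le> \<delta>) \<Longrightarrow> norm (z t - z' t) \<le> K * \<delta>"
    using forced_solution_stable by blast
  \<comment> \<open>\<open>R\<close> solves \<open>\<mu> * \<chi>\<^sub>0 * (C + 1 + \<theta> * R) = R\<close>: the contraction bound reproduces
    itself, the summand 1 leaving room for \<open>\<epsilon> \<le> 1\<close>.\<close>
  define R where "R = \<mu> * \<chi>\<^sub>0 * (C + 1) / (1 - \<mu> * \<chi>\<^sub>0 * \<theta>)"
  define M where "M = C + 1 + \<theta> * R"
  define S :: "(real \<Rightarrow>\<^sub>C (real ^ 'n)) set" where "S = periodic_cone \<omega> \<sigma> R (A * (R + M))"
  have R0: "0 \<le> R" unfolding R_def using \<mu>_pos chi_pos C \<theta> by simp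
  have MR: "\<mu> * \<chi>\<^sub>0 * M = R"
    using \<theta>(2) unfolding M_def R_def by (simp add: field_simps)
  have M0: "0 \<le> M" using C \<theta> R0 by (simp add: M_def)
  \<comment> \<open>The forcing computed from \<open>p = (\<epsilon>, y)\<close>; the parameter \<open>\<epsilon>\<close> is part of the
    argument so that one continuity statement also covers the limit \<open>\<epsilon> \<rightarrow> 0\<close>.\<close>
  define G where "G p i t = H i (l1norm (snd p 0), snd p (t - \<tau> t)) + fst p"
    for p :: "real \<times> (real \<Rightarrow>\<^sub>C (real ^ 'n))" and i t
  have region: "(l1norm (y 0), y u) \<in> harnack_region" if "y \<in> S"
    for y :: "real \<Rightarrow>\<^sub>C (real ^ 'n)" and u
    using that unfolding S_def by (rule periodic_cone_region)
  have adm: "admissible (G p)" if "snd p \<in> S" for p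
    unfolding admissible_def G_def
  proof (intro conjI allI)
    fix i
    show "continuous_on UNIV (\<lambda>t. H i (l1norm (snd p 0), snd p (t - \<tau> t)) + fst p)"
      using region[OF that]
      by (intro continuous_intros continuous_on_compose2[OF Hcont]
          continuous_on_compose2[OF continuous_on_apply_bcontfun[of UNIV]] \<tau>(1)) auto
    fix t
    have "snd p (t - \<tau> t + \<omega>) = snd p (t - \<tau> t)"
      using that by (simp add: S_def periodic_cone_def)
    moreover have "t + \<omega> - \<tau> (t + \<omega>) = t - \<tau> t + \<omega>" by (simp add: \<tau>(2))
    ultimately have eq: "snd p (t + \<omega> - \<tau> (t + \<omega>)) = snd p (t - \<tau> t)" by metis
    show "H i (l1norm (snd p 0), snd p (t + \<omega> - \<tau> (t + \<omega>))) + fst p =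
      H i (l1norm (snd p 0), snd p (t - \<tau> t)) + fst p"
      unfolding eq ..
  qed
  have Gbounds: "0 \<le> G p i t" "G p i t \<le> M" if p: "p \<in> {0..1} \<times> S" for p i t
  proof -
    have y: "snd p \<in> S" and e: "0 \<le> fst p" "fst p \<le> 1" using p by auto
    show "0 \<le> G p i t" using Hnn[OF region[OF y]] e by (simp add: G_def)
    have "l1norm (snd p (t - \<tau> t)) \<le> R"
      using y unfolding S_def by (rule periodic_cone_l1norm_le)
    then have "\<theta> * l1norm (snd p (t - \<tau> t)) \<le> \<theta> * R" using \<theta> by (intro mult_left_mono)
    then show "G p i t \<le> M" using Hup[OF region[OF y], of i "t - \<tau> t"] e by (simp add: G_def M_def)
  qed
  have "\<exists>z\<in>S. forced_solution (G p) (apply_bcontfun z)" if p: "p \<in> {0..1} \<times> S" for p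
  proof -
    have ap: "admissible (G p)" using adm p by auto
    obtain z where z: "forced_solution (G p) z" using forced_solution_exists[OF ap] by blast
    note nn = forced_solution_nonneg[OF ap z Gbounds(1)[OF p]]
    have sum: "(\<Sum>i\<in>UNIV. z t $ i) \<le> R" for t
      using forced_solution_upper[OF ap z Gbounds[OF p]] MR by simp
    have le: "\<bar>z t $ i\<bar> \<le> R" for t i
      using member_le_sum[of i UNIV "\<lambda>i. z t $ i"] nn sum[of t] by (simp add: order_trans)
    have orth: "z t \<in> orthant" for t using nn by (simp add: orthant_def)
    have "norm (z t) \<le> R" for t
      using norm_le_l1norm[of "z t"] sum[of t] l1norm_orthant[OF orth] by simp
    then have "z \<in> bcontfun" by (intro bcontfun_normI[OF forced_solution_continuous[OF z]])
    then have Bz: "apply_bcontfun (Bcontfun z) = z" by (rule Bcontfun_inverse)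
    have "Bcontfun z \<in> S"
      unfolding S_def periodic_cone_def mem_Collect_eq Bz
    proof (intro conjI allI)
      fix t u i
      show "\<bar>z t $ i - z u $ i\<bar> \<le> A * (R + M) * \<bar>t - u\<bar>"
        by (rule lip[OF z]) (use le Gbounds[OF p] in \<open>auto simp: abs_of_nonneg\<close>)
      show "\<sigma> * z t $ i \<le> z u $ i" by (rule forced_solution_harnack[OF ap z Gbounds(1)[OF p]])
    qed (simp_all add: forced_solution_periodic[OF z] nn sum)
    then show ?thesis using z Bz by metis
  qed
  then obtain T where T: "\<And>p. p \<in> {0..1} \<times> S \<Longrightarrow> T p \<in> S"
    "\<And>p. p \<in> {0..1} \<times> S \<Longrightarrow> forced_solution (G p) (apply_bcontfun (T p))"
    by metis
  have contT: "continuous_on ({0..1} \<times> S) T"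
  proof (rule continuous_on_sequentiallyI)
    fix P and p :: "real \<times> (real \<Rightarrow>\<^sub>C (real ^ 'n))"
    assume P: "\<forall>n. P n \<in> {0..1} \<times> S" and p: "p \<in> {0..1} \<times> S" and lim: "P \<longlonglongrightarrow> p"
    show "(\<lambda>n. T (P n)) \<longlonglongrightarrow> T p"
    proof (rule tendstoI)
      fix e :: real assume "0 < e"
      define \<delta> where "\<delta> = e / (4 * K)"
      have \<delta>: "0 < \<delta>" using \<open>0 < e\<close> K by (simp add: \<delta>_def)
      let ?D = "harnack_region \<inter> {p. l1norm (snd p) \<le> R}"
      have "uniformly_continuous_on ?D (\<lambda>p. \<chi> i. H i p)"
        by (intro compact_uniformly_continuous compact_harnack_region continuous_on_vec_lambda
            continuous_on_subset[OF Hcont]) auto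
      then obtain d where d: "0 < d"
        and unif: "\<And>q q'. q \<in> ?D \<Longrightarrow> q' \<in> ?D \<Longrightarrow> dist q' q < d \<Longrightarrow>
          dist (\<chi> i. H i q') (\<chi> i. H i q) < \<delta>"
        unfolding uniformly_continuous_on_def using \<delta> by meson
      have lim1: "(\<lambda>n. fst (P n)) \<longlonglongrightarrow> fst p" and lim2: "(\<lambda>n. snd (P n)) \<longlonglongrightarrow> snd p"
        using lim by (auto intro: tendsto_fst tendsto_snd)
      have lim3: "(\<lambda>n. l1norm (snd (P n) 0)) \<longlonglongrightarrow> l1norm (snd p 0)"
        using continuous_on_tendsto_compose[OF continuous_on_l1norm[OF continuous_on_eval_bcontfun[of UNIV 0]] lim2]
        by simp
      have "\<forall>\<^sub>F n in sequentially. dist (fst (P n)) (fst p) < \<delta> \<and> dist (snd (P n)) (snd p) < d / 2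
          \<and> dist (l1norm (snd (P n) 0)) (l1norm (snd p 0)) < d / 2"
        using \<delta> d by (intro eventually_conj tendstoD[OF lim1] tendstoD[OF lim2] tendstoD[OF lim3]) auto
      then show "\<forall>\<^sub>F n in sequentially. dist (T (P n)) (T p) < e"
      proof eventually_elim
        case (elim n)
        have S: "snd (P n) \<in> S" "snd p \<in> S" using P p by (auto simp: mem_Times_iff)
        have "\<bar>G (P n) i t - G p i t\<bar> \<le> 2 * \<delta>" for i t
        proof -
          let ?q' = "(l1norm (snd (P n) 0), snd (P n) (t - \<tau> t))"
          let ?q = "(l1norm (snd p 0), snd p (t - \<tau> t))"
          have "dist ?q' ?q \<le> dist (fst ?q') (fst ?q) + dist (snd ?q') (snd ?q)"
            unfolding dist_Pair_Pair fst_conv snd_conv by (rule sqrt_sum_squares_le_sum) auto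
          also have "\<dots> < d"
            using elim dist_bounded[of "snd (P n)" "t - \<tau> t" "snd p"] by simp
          finally have "dist (\<chi> i. H i ?q') (\<chi> i. H i ?q) < \<delta>"
            using S region periodic_cone_l1norm_le unfolding S_def by (intro unif) auto
          then have "\<bar>H i ?q' - H i ?q\<bar> < \<delta>"
            using component_le_norm_cart[of "(\<chi> i. H i ?q') - (\<chi> i. H i ?q)" i]
            by (simp add: dist_norm)
          moreover have "\<bar>fst (P n) - fst p\<bar> < \<delta>" using elim by (simp add: dist_real_def)
          ultimately show ?thesis unfolding G_def by linarith
        qed
        then have "norm (T (P n) t - T p t) \<le> K * (2 * \<delta>)" for t
          using P p S by (intro stable[OF adm adm T(2) T(2)]) auto
        then have "dist (T (P n)) (T p) \<le> K * (2 * \<delta>)"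
          by (intro dist_bound) (simp add: dist_norm)
        also have "\<dots> < e" using \<open>0 < e\<close> K by (simp add: \<delta>_def)
        finally show ?case .
      qed
    qed
  qed
  have compS: "compact S" unfolding S_def
    using A R0 M0 period_pos by (intro compact_periodic_cone) auto
  have convS: "convex S" unfolding S_def by (rule convex_periodic_cone)
  have "0 \<in> S" using R0 M0 A by (simp add: S_def periodic_cone_def)
  then have neS: "S \<noteq> {}" by blast
  define \<epsilon> where "\<epsilon> n = inverse (real (Suc n))" for n
  have \<epsilon>: "0 < \<epsilon> n" "\<epsilon> n \<le> 1" for n by (simp_all add: \<epsilon>_def inverse_le_1_iff)
  have "\<exists>y. y \<in> S \<and> T (\<epsilon> n, y) = y" for n
  proof -
    have cont: "continuous_on S (\<lambda>y. T (\<epsilon> n, y))"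
      using \<epsilon>[of n] by (intro continuous_on_compose2[OF contT] continuous_intros) auto
    have maps: "(\<lambda>y. T (\<epsilon> n, y)) ` S \<subseteq> S"
      using \<epsilon>[of n] T(1) by auto
    show ?thesis
      by (rule schauder_fixed_point[OF compS convS neS cont maps]) blast
  qed
  then obtain y where y: "\<And>n. y n \<in> S" "\<And>n. T (\<epsilon> n, y n) = y n" by metis
  have far: "r < l1norm (y n 0)" for n
  proof (rule ccontr)
    assume "\<not> r < l1norm (y n 0)"
    then have small: "l1norm (y n 0) \<le> r" by simp
    have p: "(\<epsilon> n, y n) \<in> {0..1} \<times> S" using \<epsilon>[of n] y by simp
    have low: "\<eta> * (\<sigma> * l1norm (y n 0)) + \<epsilon> n \<le> G (\<epsilon> n, y n) j t" for t
    proof -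
      have "\<sigma> * l1norm (y n 0) \<le> l1norm (y n (t - \<tau> t))"
        using region[OF y(1)[of n]] by (simp add: harnack_region_def)
      then have "\<eta> * (\<sigma> * l1norm (y n 0)) \<le> \<eta> * l1norm (y n (t - \<tau> t))"
        using \<eta>(1) by (rule mult_left_mono)
      also have "\<dots> \<le> H j (l1norm (y n 0), y n (t - \<tau> t))"
        using Hlow[OF region[OF y(1)[of n]], of "t - \<tau> t"] small by simp
      finally show ?thesis by (simp add: G_def)
    qed
    have "\<mu> * \<Gamma> * (\<eta> * (\<sigma> * l1norm (y n 0)) + \<epsilon> n) \<le> y n 0 $ j"
      using forced_solution_lower[OF adm T(2)[OF p] low] y \<eta>(1) sigma_bounds \<epsilon>[of n]
      by (simp add: l1norm_nonneg)
    also have "\<dots> \<le> l1norm (y n 0)" using component_le_l1norm[of "y n 0" j] by simp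
    also have "\<dots> \<le> \<mu> * \<Gamma> * (\<sigma> * \<eta>) * l1norm (y n 0)"
      using mult_right_mono[OF \<eta>(2) l1norm_nonneg] by simp
    finally have "\<mu> * \<Gamma> * \<epsilon> n \<le> 0" by (simp add: algebra_simps)
    then show False using \<mu>_pos Gamma_pos \<epsilon>(1)[of n] by (simp add: mult_le_0_iff)
  qed
  obtain l k where l: "l \<in> S" and k: "strict_mono k" and lim: "(y \<circ> k) \<longlonglongrightarrow> l"
    using compS y(1) unfolding compact_eq_seq_compact_metric seq_compact_def by meson
  have "(\<lambda>n. \<epsilon> (k n)) \<longlonglongrightarrow> 0"
    using LIMSEQ_subseq_LIMSEQ[OF LIMSEQ_inverse_real_of_nat k] by (simp add: o_def \<epsilon>_def)
  then have "(\<lambda>n. (\<epsilon> (k n), y (k n))) \<longlonglongrightarrow> (0, l)"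
    using lim by (intro tendsto_Pair) (simp_all add: o_def)
  then have "(\<lambda>n. T (\<epsilon> (k n), y (k n))) \<longlonglongrightarrow> T (0, l)"
    using l y(1) \<epsilon> by (intro continuous_on_tendsto_compose[OF contT]) (auto simp: less_imp_le)
  then have Tl: "T (0, l) = l"
    using lim LIMSEQ_unique by (fastforce simp: y(2) o_def)
  have "(\<lambda>n. l1norm (y (k n) 0)) \<longlonglongrightarrow> l1norm (l 0)"
    using continuous_on_tendsto_compose[OF continuous_on_l1norm[OF continuous_on_eval_bcontfun[of UNIV 0]] lim]
    by (simp add: o_def)
  then have "r \<le> l1norm (l 0)"
    by (rule LIMSEQ_le_const) (use far less_imp_le in blast)
  moreover have "forced_solution (\<lambda>i t. H i (l1norm (l 0), l (t - \<tau> t))) l"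
  proof -
    have "G (0, l) = (\<lambda>i t. H i (l1norm (l 0), l (t - \<tau> t)))"
      by (simp add: G_def fun_eq_iff)
    then show ?thesis using T(2)[of "(0, l)"] l by (simp add: Tl)
  qed
  ultimately show ?thesis
    using l r by (intro exI[of _ "apply_bcontfun l"]) (auto simp: S_def periodic_cone_def)
qed

end

section \<open>Slopes of the nonlinearity near zero and near infinity\<close>

lemma eventually_orthant_at_0:
  "eventually P orthant_at_0 \<longleftrightarrow>
    (\<exists>\<delta>>0. \<forall>x\<in>orthant. 0 < l1norm x \<longrightarrow> l1norm x < \<delta> \<longrightarrow> P x)"
  unfolding orthant_at_0_def eventually_inf_principal eventually_filtercomap eventually_at_right_field
proof safe
  fix Q and \<delta> :: real
  assume "\<forall>x. Q (l1norm x) \<longrightarrow> x \<in> orthant \<longrightarrow> P x" "0 < \<delta>" "\<forall>y>0. y < \<delta> \<longrightarrow> Q y"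
  then show "\<exists>\<delta>>0. \<forall>x\<in>orthant. 0 < l1norm x \<longrightarrow> l1norm x < \<delta> \<longrightarrow> P x" by blast
next
  fix \<delta> :: real
  assume "0 < \<delta>" "\<forall>x\<in>orthant. 0 < l1norm x \<longrightarrow> l1norm x < \<delta> \<longrightarrow> P x"
  then show "\<exists>Q. (\<exists>b>0. \<forall>y>0. y < b \<longrightarrow> Q y) \<and> (\<forall>x. Q (l1norm x) \<longrightarrow> x \<in> orthant \<longrightarrow> P x)"
    by (intro exI[of _ "\<lambda>r. 0 < r \<and> r < \<delta>"]) blast
qed

lemma eventually_orthant_at_infinity:
  "eventually P orthant_at_infinity \<longleftrightarrow> (\<exists>N. \<forall>x\<in>orthant. N \<le> l1norm x \<longrightarrow> P x)"
  unfolding orthant_at_infinity_def eventually_inf_principal eventually_filtercomap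
    eventually_at_top_linorder
proof safe
  fix Q and N :: real
  assume "\<forall>x. Q (l1norm x) \<longrightarrow> x \<in> orthant \<longrightarrow> P x" "\<forall>r\<ge>N. Q r"
  then show "\<exists>N. \<forall>x\<in>orthant. N \<le> l1norm x \<longrightarrow> P x" by blast
next
  fix N :: real
  assume "\<forall>x\<in>orthant. N \<le> l1norm x \<longrightarrow> P x"
  then show "\<exists>Q. (\<exists>N. \<forall>r\<ge>N. Q r) \<and> (\<forall>x. Q (l1norm x) \<longrightarrow> x \<in> orthant \<longrightarrow> P x)"
    by (intro exI[of _ "\<lambda>r. N \<le> r"]) blast
qed

lemma orthant_sphere_nonempty:
  assumes "0 \<le> r"
  shows "\<exists>x :: real ^ 'n::finite. x \<in> orthant \<and> l1norm x = r"
  using assms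
  by (intro exI[of _ "\<chi> i. r / real CARD('n)"]) (simp add: orthant_def l1norm_def)

lemma orthant_at_0_neq_bot: "(orthant_at_0 :: (real ^ 'n::finite) filter) \<noteq> bot"
proof
  assume "(orthant_at_0 :: (real ^ 'n) filter) = bot"
  then have "eventually (\<lambda>_. False) (orthant_at_0 :: (real ^ 'n) filter)" by simp
  then obtain \<delta> :: real where "0 < \<delta>" "\<forall>x\<in>(orthant :: (real ^ 'n) set). 0 < l1norm x \<longrightarrow> \<not> l1norm x < \<delta>"
    unfolding eventually_orthant_at_0 by blast
  then show False using orthant_sphere_nonempty[of "\<delta> / 2", where 'n = 'n] by fastforce
qed

lemma orthant_at_infinity_neq_bot: "(orthant_at_infinity :: (real ^ 'n::finite) filter) \<noteq> bot"
proof
  assume "(orthant_at_infinity :: (real ^ 'n) filter) = bot"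
  then have "eventually (\<lambda>_. False) (orthant_at_infinity :: (real ^ 'n) filter)" by simp
  then obtain N :: real where "\<forall>x\<in>(orthant :: (real ^ 'n) set). \<not> N \<le> l1norm x"
    unfolding eventually_orthant_at_infinity by blast
  then show False using orthant_sphere_nonempty[of "max 0 N", where 'n = 'n] by fastforce
qed

lemma max_limit_nonneg:
  fixes f :: "'n::finite \<Rightarrow> real ^ 'n \<Rightarrow> real" and L :: "'n \<Rightarrow> ereal"
  assumes "F \<noteq> bot" "\<And>i. ((\<lambda>x. ereal (f i x / l1norm x)) \<longlongrightarrow> L i) F"
    and "\<forall>\<^sub>F x in F. x \<in> orthant" "\<And>i x. x \<in> orthant \<Longrightarrow> 0 \<le> f i x"
  shows "0 \<le> (MAX i. L i)"
proof -
  have "0 \<le> L i" for i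
  proof (rule tendsto_lowerbound[OF assms(2) _ assms(1)])
    show "\<forall>\<^sub>F x in F. 0 \<le> ereal (f i x / l1norm x)"
      using assms(3) by eventually_elim (simp add: assms(4) l1norm_nonneg)
  qed
  then show ?thesis by (meson Max_ge UNIV_I finite finite_imageI image_eqI order_trans)
qed

lemma eventually_below_slope:
  fixes f :: "'n::finite \<Rightarrow> real ^ 'n \<Rightarrow> real" and L :: "'n \<Rightarrow> ereal"
  assumes "\<And>i. ((\<lambda>x. ereal (f i x / l1norm x)) \<longlongrightarrow> L i) F" "(MAX i. L i) < ereal \<theta>"
  shows "\<forall>\<^sub>F x in F. \<forall>i. f i x / l1norm x < \<theta>"
proof (rule eventually_all_finite)
  fix i
  have "L i < ereal \<theta>" using assms(2) by (simp add: Max_less_iff)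
  from order_tendstoD(2)[OF assms(1) this]
  show "\<forall>\<^sub>F x in F. f i x / l1norm x < \<theta>" by simp
qed

lemma eventually_above_slope:
  fixes f :: "'n::finite \<Rightarrow> real ^ 'n \<Rightarrow> real" and L :: "'n \<Rightarrow> ereal"
  assumes "\<And>i. ((\<lambda>x. ereal (f i x / l1norm x)) \<longlongrightarrow> L i) F" "ereal \<eta> < (MAX i. L i)"
  shows "\<exists>j. \<forall>\<^sub>F x in F. \<eta> < f j x / l1norm x"
proof -
  obtain j where "ereal \<eta> < L j" using assms(2) by (auto simp: Max_gr_iff)
  from order_tendstoD(1)[OF assms(1) this] show ?thesis by auto
qed

lemma bounded_on_orthant_ball:
  fixes f :: "'n::finite \<Rightarrow> real ^ 'n \<Rightarrow> real"
  assumes "\<And>i. continuous_on orthant (f i)"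
  shows "\<exists>C\<ge>0. \<forall>i. \<forall>x\<in>orthant. l1norm x \<le> N \<longrightarrow> f i x \<le> C"
proof -
  let ?B = "orthant \<inter> {x :: real ^ 'n. l1norm x \<le> N}"
  have "closed ?B" by (intro closed_Int closed_orthant closed_Collect_le continuous_intros)
  moreover have "bounded ?B"
    unfolding bounded_iff using norm_le_l1norm order_trans by blast
  ultimately have "compact ?B" by (simp add: compact_eq_bounded_closed)
  moreover have "continuous_on ?B (\<lambda>x. \<chi> i. f i x)"
    by (intro continuous_on_vec_lambda continuous_on_subset[OF assms]) auto
  ultimately have "bounded ((\<lambda>x. \<chi> i. f i x) ` ?B)"
    by (intro compact_imp_bounded compact_continuous_image)
  then obtain C where C: "\<And>x. x \<in> ?B \<Longrightarrow> norm (\<chi> i. f i x) \<le> C" by (auto simp: bounded_iff)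
  have "f i x \<le> max 0 C" if "x \<in> ?B" for i x
    using component_le_norm_cart[of "\<chi> i. f i x" i] C[OF that] by simp
  then show ?thesis by (intro exI[of _ "max 0 C"]) auto
qed

context periodic_system
begin

lemma harnack_regionD:
  assumes "p \<in> harnack_region"
  shows "snd p \<in> orthant" "\<sigma> * fst p \<le> l1norm (snd p)" "l1norm (snd p) \<le> fst p / \<sigma>" "0 \<le> fst p"
proof -
  show "snd p \<in> orthant" "\<sigma> * fst p \<le> l1norm (snd p)"
    using assms by (simp_all add: harnack_region_def orthant_def)
  have le: "\<sigma> * l1norm (snd p) \<le> fst p" using assms by (simp add: harnack_region_def)
  then show "l1norm (snd p) \<le> fst p / \<sigma>"
    using sigma_bounds(1) by (simp add: pos_le_divide_eq mult.commute)
  have "0 \<le> \<sigma> * l1norm (snd p)" using sigma_bounds(1) l1norm_nonneg[of "snd p"] by simp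
  then show "0 \<le> fst p" using le by linarith
qed

lemma positive_function_harnack:
  assumes "\<And>t i. 0 \<le> y t $ i" "\<And>t u i. \<sigma> * y t $ i \<le> y u $ i" "0 < l1norm (y 0)"
  shows "positive_function y"
proof -
  have "\<exists>i. y 0 $ i \<noteq> 0" using assms(3) l1norm_eq_0[of "y 0"] by (auto simp: vec_eq_iff)
  then obtain i where "0 < y 0 $ i" using assms(1) by (metis order_le_less)
  then have "0 < y t $ i" for t
    using assms(2)[of 0 i t] mult_pos_pos[OF sigma_bounds(1)] by fastforce
  then show ?thesis using assms(1) by (auto simp: positive_function_def)
qed

lemma forced_solution_is_solution:
  "forced_solution (\<lambda>i t. f i (x (t - \<tau> t))) x \<Longrightarrow> is_solution a b \<tau> f \<mu> x \<and> periodic_fun_simple x \<omega>"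
  by (simp add: forced_solution_def is_solution_def periodic_fun_simple_def)

context
  fixes \<tau> :: "real \<Rightarrow> real" and f :: "'n \<Rightarrow> real ^ 'n \<Rightarrow> real" and \<theta> \<eta> :: real and j :: 'n
  assumes \<tau>: "continuous_on UNIV \<tau>" "\<And>t. \<tau> (t + \<omega>) = \<tau> t"
    and f_cont: "\<And>i. continuous_on orthant (f i)" and f_nonneg: "\<And>i x. x \<in> orthant \<Longrightarrow> 0 \<le> f i x"
    and \<theta>: "0 \<le> \<theta>" "\<mu> * \<chi>\<^sub>0 * \<theta> < 1" and \<eta>: "0 \<le> \<eta>" "1 \<le> \<mu> * \<Gamma> * (\<sigma> * \<eta>)"
begin

section \<open>The two cases\<close>

text \<open>
  Large slope near 0 and small slope near infinity is exactly the compression situation.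
\<close>

lemma positive_solution_steep_at_zero:
  assumes low: "0 < \<delta>" "\<And>x. x \<in> orthant \<Longrightarrow> 0 < l1norm x \<Longrightarrow> l1norm x < \<delta> \<Longrightarrow> \<eta> * l1norm x \<le> f j x"
    and up: "\<And>i x. x \<in> orthant \<Longrightarrow> N \<le> l1norm x \<Longrightarrow> f i x \<le> \<theta> * l1norm x"
  shows "\<exists>x. is_solution a b \<tau> f \<mu> x \<and> periodic_fun_simple x \<omega> \<and> positive_function x"
proof -
  obtain C where C: "0 \<le> C" "\<And>i x. x \<in> orthant \<Longrightarrow> l1norm x \<le> N \<Longrightarrow> f i x \<le> C"
    using bounded_on_orthant_ball[of f, OF f_cont] by blast
  have "\<exists>y. forced_solution (\<lambda>i t. f i (snd (l1norm (y 0), y (t - \<tau> t)))) y \<and> (\<forall>t i. 0 \<le> y t $ i) \<and>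
    (\<forall>t u i. \<sigma> * y t $ i \<le> y u $ i) \<and> 0 < l1norm (y 0)"
  proof (rule compression_fixed_point[OF \<tau> _ _ _ C(1) \<theta> _ _ \<eta>])
    show "continuous_on harnack_region (\<lambda>p. f i (snd p))" for i
      using harnack_regionD(1) by (intro continuous_on_compose2[OF f_cont] continuous_intros) auto
    fix p i assume p: "p \<in> harnack_region"
    note v = harnack_regionD[OF p]
    show "0 \<le> f i (snd p)" using f_nonneg v by blast
    show "f i (snd p) \<le> C + \<theta> * l1norm (snd p)"
    proof (cases "l1norm (snd p) \<le> N")
      case True
      then show ?thesis using C(2)[OF v(1) True, of i] \<theta>(1) l1norm_nonneg[of "snd p"]
        by (simp add: add_increasing2)
    next
      case False
      then show ?thesis using up[OF v(1), of i] C(1) by simp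
    qed
  next
    fix p assume p: "p \<in> harnack_region" "fst p \<le> \<sigma> * \<delta> / 2"
    note v = harnack_regionD[OF p(1)]
    have "l1norm (snd p) \<le> (\<sigma> * \<delta> / 2) / \<sigma>"
      using v(3) divide_right_mono[OF p(2), of \<sigma>] sigma_bounds(1) by linarith
    then have "l1norm (snd p) < \<delta>" using low(1) sigma_bounds(1) by simp
    then show "\<eta> * l1norm (snd p) \<le> f j (snd p)"
      using low(2)[OF v(1)] f_nonneg[OF v(1), of j] l1norm_nonneg[of "snd p"]
      by (cases "l1norm (snd p) = 0") auto
  qed (use low(1) sigma_bounds(1) in simp)
  then obtain y where "forced_solution (\<lambda>i t. f i (y (t - \<tau> t))) y" "\<And>t i. 0 \<le> y t $ i"
    "\<And>t u i. \<sigma> * y t $ i \<le> y u $ i" "0 < l1norm (y 0)" by auto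
  then show ?thesis using forced_solution_is_solution positive_function_harnack by blast
qed

text \<open>
  Here the operator contracts near 0 and expands near infinity. Substituting \<open>x = y / c\<^sup>2\<close>
  with \<open>c = l1norm (y 0)\<close> inverts the size, since \<open>l1norm (x 0) = 1 / c\<close>, and turns the
  equation for \<open>x\<close> into the one for \<open>y\<close> with nonlinearity \<open>H i (c, v) = c\<^sup>2 * f i (v / c\<^sup>2)\<close>.
  The factor \<open>c\<^sup>2\<close> preserves slopes, so \<open>H\<close> has near 0 the slopes of \<open>f\<close> near infinity and
  conversely, and the compression argument applies to it. The linear bound on \<open>f\<close> extends \<open>H\<close>
  continuously by 0 to \<open>c = 0\<close>, where the Harnack region contains only the origin.
\<close>

lemma positive_solution_steep_at_infinity:
  assumes low: "\<And>x. x \<in> orthant \<Longrightarrow> N \<le> l1norm x \<Longrightarrow> \<eta> * l1norm x \<le> f j x"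
    and up: "0 < \<delta>" "\<And>i x. x \<in> orthant \<Longrightarrow> 0 < l1norm x \<Longrightarrow> l1norm x < \<delta> \<Longrightarrow> f i x \<le> \<theta> * l1norm x"
    and lin: "\<And>i x. x \<in> orthant \<Longrightarrow> 0 < l1norm x \<Longrightarrow> f i x \<le> D * l1norm x" "0 \<le> D"
  shows "\<exists>x. is_solution a b \<tau> f \<mu> x \<and> periodic_fun_simple x \<omega> \<and> positive_function x"
proof -
  define H where "H i p = (fst p)\<^sup>2 * f i (inverse ((fst p)\<^sup>2) *\<^sub>R snd p)"
    for i and p :: "real \<times> (real ^ 'n)"
  have s: "0 < \<sigma>" by (rule sigma_bounds)
  have scale: "inverse (c\<^sup>2) *\<^sub>R v \<in> orthant" "l1norm (inverse (c\<^sup>2) *\<^sub>R v) = l1norm v / c\<^sup>2"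
    if "v \<in> orthant" for c and v :: "real ^ 'n"
    using that by (simp_all add: orthant_def l1norm_scaleR divide_inverse mult.commute)
  have H0: "H i p = 0" if "fst p = 0" for i p using that by (simp add: H_def)
  have Hnn: "0 \<le> H i p" if "p \<in> harnack_region" for i p
    using f_nonneg[OF scale(1)[OF harnack_regionD(1)[OF that]]] by (simp add: H_def)
  have Hle: "H i p \<le> e * l1norm (snd p)"
    if p: "p \<in> harnack_region" "0 < fst p" and e: "f i (inverse ((fst p)\<^sup>2) *\<^sub>R snd p) \<le> e * (l1norm (snd p) / (fst p)\<^sup>2)"
    for i p e
  proof -
    have "H i p \<le> (fst p)\<^sup>2 * (e * (l1norm (snd p) / (fst p)\<^sup>2))"
      unfolding H_def using e by (rule mult_left_mono) simp
    then show ?thesis using p(2) by simp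
  qed
  have vpos: "0 < l1norm (snd p)" if "p \<in> harnack_region" "0 < fst p" for p
    using harnack_regionD(2)[OF that(1)] mult_pos_pos[OF s that(2)] by linarith
  have Hlin: "H i p \<le> D * l1norm (snd p)" if p: "p \<in> harnack_region" for i p
  proof (cases "fst p = 0")
    case True
    then show ?thesis using lin(2) l1norm_nonneg[of "snd p"] by (simp add: H0)
  next
    case False
    then have pos: "0 < fst p" using harnack_regionD(4)[OF p] by simp
    note v = scale[OF harnack_regionD(1)[OF p], of "fst p"]
    show ?thesis
      using lin(1)[OF v(1), of i] vpos[OF p pos] pos by (intro Hle p pos) (simp add: v(2))
  qed
  have Hcont: "continuous_on harnack_region (H i)" for i
    unfolding continuous_on_eq_continuous_within
  proof
    fix p assume p: "p \<in> harnack_region"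
    show "continuous (at p within harnack_region) (H i)"
    proof (cases "fst p = 0")
      case True
      then have "l1norm (snd p) = 0"
        using harnack_regionD(3)[OF p] l1norm_nonneg[of "snd p"] by simp
      moreover have "((\<lambda>q. D * l1norm (snd q)) \<longlongrightarrow> D * l1norm (snd p)) (at p within harnack_region)"
        using p continuous_on_mult_left[OF continuous_on_l1norm[OF continuous_on_snd[OF continuous_on_id]]]
        unfolding continuous_on_def by blast
      ultimately have lim: "((\<lambda>q. D * l1norm (snd q)) \<longlongrightarrow> 0) (at p within harnack_region)" by simp
      have "(H i \<longlongrightarrow> 0) (at p within harnack_region)"
      proof (rule tendsto_sandwich[OF _ _ tendsto_const lim])
        show "\<forall>\<^sub>F q in at p within harnack_region. 0 \<le> H i q"
          using Hnn by (simp add: eventually_at_filter)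
        show "\<forall>\<^sub>F q in at p within harnack_region. H i q \<le> D * l1norm (snd q)"
          using Hlin by (simp add: eventually_at_filter)
      qed
      then show ?thesis by (simp add: continuous_within H0[OF True])
    next
      case False
      let ?U = "{q :: real \<times> (real ^ 'n). 0 < fst q}"
      have pU: "p \<in> ?U" using False harnack_regionD(4)[OF p] by simp
      have "continuous_on (harnack_region \<inter> ?U) (H i)"
        unfolding H_def
        by (intro continuous_intros continuous_on_compose2[OF f_cont])
          (auto intro!: scale harnack_regionD)
      then have "continuous (at p within harnack_region \<inter> ?U) (H i)"
        using p pU by (simp add: continuous_on_eq_continuous_within)
      moreover have "at p within harnack_region = at p within harnack_region \<inter> ?U"
        by (rule at_within_nhd[of p ?U]) (use pU in \<open>auto intro!: open_Collect_less continuous_intros\<close>)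
      ultimately show ?thesis by simp
    qed
  qed
  \<comment> \<open>For \<open>c > 2 / (\<sigma> * \<delta>)\<close> the argument \<open>v / c\<^sup>2\<close> of \<open>f\<close> has size below \<open>\<delta>\<close>; for
    smaller \<open>c\<close> the linear bound gives \<open>C\<close>.\<close>
  define C where "C = D * (2 / (\<sigma> * \<delta>) / \<sigma>)"
  have C: "0 \<le> C" using lin(2) up(1) s by (simp add: C_def)
  \<comment> \<open>For \<open>c \<le> r\<close> the argument of \<open>f\<close> has size at least \<open>\<sigma> / c \<ge> N\<close>; the maximum
    with 1 keeps \<open>r\<close> positive.\<close>
  define r where "r = \<sigma> / max 1 N"
  have r: "0 < r" using s by (simp add: r_def)
  have "\<exists>y. forced_solution (\<lambda>i t. H i (l1norm (y 0), y (t - \<tau> t))) y \<and> (\<forall>t i. 0 \<le> y t $ i) \<and>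
    (\<forall>t u i. \<sigma> * y t $ i \<le> y u $ i) \<and> 0 < l1norm (y 0)"
  proof (rule compression_fixed_point[OF \<tau> Hcont Hnn _ C \<theta> _ r \<eta>])
    fix p i assume p: "p \<in> harnack_region"
    note v = harnack_regionD[OF p]
    show "H i p \<le> C + \<theta> * l1norm (snd p)"
    proof (cases "fst p \<le> 2 / (\<sigma> * \<delta>)")
      case True
      have "H i p \<le> D * (fst p / \<sigma>)"
        using Hlin[OF p, of i] mult_left_mono[OF v(3) lin(2)] by linarith
      also have "\<dots> \<le> C"
        unfolding C_def using True s lin(2) by (intro mult_left_mono divide_right_mono) auto
      finally show ?thesis using \<theta>(1) l1norm_nonneg[of "snd p"] by (simp add: add_increasing2)
    next
      case False
      then have "2 / (\<sigma> * \<delta>) < fst p" by simp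
      then have big: "2 < \<sigma> * \<delta> * fst p" using s up(1) by (simp add: pos_divide_less_eq mult_ac)
      have "0 < 2 / (\<sigma> * \<delta>)" using s up(1) by simp
      then have pos: "0 < fst p" using False by linarith
      have "l1norm (snd p) / (fst p)\<^sup>2 \<le> (fst p / \<sigma>) / (fst p)\<^sup>2"
        using v(3) by (rule divide_right_mono) simp
      also have "\<dots> = 1 / (\<sigma> * fst p)" using pos by (simp add: power2_eq_square)
      also have "\<dots> < \<delta>" using big pos s by (simp add: pos_divide_less_eq mult_ac)
      finally have "H i p \<le> \<theta> * l1norm (snd p)"
        using up(2)[OF scale(1)[OF v(1), of "fst p"], of i] vpos[OF p pos] pos
        by (intro Hle p pos) (simp add: scale(2)[OF v(1)])
      then show ?thesis using C by simp
    qed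
  next
    fix p assume p: "p \<in> harnack_region" "fst p \<le> r"
    note v = harnack_regionD[OF p(1)]
    show "\<eta> * l1norm (snd p) \<le> H j p"
    proof (cases "fst p = 0")
      case True
      then have "l1norm (snd p) = 0" using v(3) l1norm_nonneg[of "snd p"] by simp
      then show ?thesis using Hnn[OF p(1)] by simp
    next
      case False
      then have pos: "0 < fst p" using v(4) by simp
      have "max 1 N * fst p \<le> \<sigma>" using p(2) by (simp add: r_def pos_le_divide_eq mult.commute)
      then have "N * fst p \<le> \<sigma>"
        using mult_right_mono[of N "max 1 N" "fst p"] pos by linarith
      then have "N * (fst p)\<^sup>2 \<le> \<sigma> * fst p"
        using mult_right_mono[of "N * fst p" \<sigma> "fst p"] pos by (simp add: power2_eq_square mult_ac)
      also have "\<dots> \<le> l1norm (snd p)" by (rule v(2))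
      finally have "N \<le> l1norm (snd p) / (fst p)\<^sup>2" using pos by (simp add: pos_le_divide_eq)
      then have "\<eta> * (l1norm (snd p) / (fst p)\<^sup>2) \<le> f j (inverse ((fst p)\<^sup>2) *\<^sub>R snd p)"
        using low[OF scale(1)[OF v(1)]] by (simp add: scale(2)[OF v(1)])
      then have "(fst p)\<^sup>2 * (\<eta> * (l1norm (snd p) / (fst p)\<^sup>2)) \<le> H j p"
        unfolding H_def by (rule mult_left_mono) simp
      then show ?thesis using pos by simp
    qed
  qed
  then obtain y where y: "forced_solution (\<lambda>i t. H i (l1norm (y 0), y (t - \<tau> t))) y" "\<And>t i. 0 \<le> y t $ i"
    "\<And>t u i. \<sigma> * y t $ i \<le> y u $ i" and c: "0 < l1norm (y 0)" by auto
  define k where "k = inverse ((l1norm (y 0))\<^sup>2)"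
  define x where "x t = k *\<^sub>R y t" for t
  have k: "0 < k" using c by (simp add: k_def)
  have "forced_solution (\<lambda>i t. f i (x (t - \<tau> t))) x"
    unfolding forced_solution_def
  proof (intro conjI allI)
    show "x (t + \<omega>) = x t" for t by (simp add: x_def forced_solution_periodic[OF y(1)])
    fix i t
    have "k * H i (l1norm (y 0), y (t - \<tau> t)) = f i (x (t - \<tau> t))"
      using c by (simp add: H_def x_def k_def)
    then have eq: "k * (- a i t * y t $ i + \<mu> * b i t * H i (l1norm (y 0), y (t - \<tau> t)))
        = - a i t * x t $ i + \<mu> * b i t * f i (x (t - \<tau> t))"
      by (simp add: x_def algebra_simps)
    show "((\<lambda>s. x s $ i) has_real_derivative - a i t * x t $ i + \<mu> * b i t * f i (x (t - \<tau> t))) (at t)"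
      using DERIV_cmult[OF forced_solution_DERIV[OF y(1), of i t], of k]
      unfolding eq by (simp add: x_def)
  qed
  moreover have "positive_function x"
  proof (rule positive_function_harnack)
    show "0 \<le> x t $ i" for t i using y(2) k by (simp add: x_def)
    show "\<sigma> * x t $ i \<le> x u $ i" for t u i
      using mult_left_mono[OF y(3)[of t i u], of k] k by (simp add: x_def mult_ac)
    show "0 < l1norm (x 0)" using c k by (simp add: x_def l1norm_scaleR)
  qed
  ultimately show ?thesis using forced_solution_is_solution by blast
qed

end

end

section \<open>Existence of a positive periodic solution\<close>

theorem theorem2p3:
  fixes \<omega> \<mu> :: real
    and a b :: "'n::finite \<Rightarrow> real \<Rightarrow> real"
    and \<tau> :: "real \<Rightarrow> real"
    and f :: "'n \<Rightarrow> real ^ 'n \<Rightarrow> real"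
    and f0 finf :: "'n \<Rightarrow> ereal"
    and F0 Finf :: ereal
  assumes "\<omega> > 0"
    and "\<And>i. continuous_on UNIV (a i)" and "\<And>i t. 0 \<le> a i t"
    and "\<And>i. periodic_fun_simple (a i) \<omega>" and "\<And>i. mean \<omega> (a i) > 0"
    and "\<And>i. continuous_on UNIV (b i)" and "\<And>i t. 0 \<le> b i t"
    and "\<And>i. periodic_fun_simple (b i) \<omega>" and "\<And>i. mean \<omega> (b i) > 0"
    and "continuous_on UNIV \<tau>" and "periodic_fun_simple \<tau> \<omega>"
    and "\<And>i. continuous_on orthant (f i)"
    and "\<And>i x. x \<in> orthant \<Longrightarrow> 0 \<le> f i x"
    and "\<And>i x. x \<in> orthant \<Longrightarrow> l1norm x > 0 \<Longrightarrow> f i x > 0"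
    and "\<And>i. is_lim_zero (f i) (f0 i)"
    and "\<And>i. is_lim_infinity (f i) (finf i)"
    and "F0 = (MAX i. f0 i)" and "Finf = (MAX i. finf i)"
    and "num_zeros F0 Finf = 0" and "num_infinities F0 Finf = 0"
    and "ereal (1 / (sigma_min \<omega> a * Gamma_const \<omega> a b)) * (1 / max F0 Finf) < ereal \<mu>"
    and "ereal \<mu> < ereal (1 / chi_const \<omega> a b) * (1 / min F0 Finf)"
  shows "\<exists>x :: real \<Rightarrow> real ^ 'n.
           is_solution a b \<tau> f \<mu> x \<and> periodic_fun_simple x \<omega> \<and> positive_function x"
proof -
  have per: "h (t + \<omega>) = h t" if "periodic_fun_simple h \<omega>" for h :: "real \<Rightarrow> real" and t
    using that by (simp add: periodic_fun_simple_def)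
  interpret periodic_coefficients \<omega> a b
    by unfold_locales (use assms(1-9) per in blast)+
  note lim0 = assms(15)[unfolded is_lim_zero_def] and liminf = assms(16)[unfolded is_lim_infinity_def]
  have orth0: "\<forall>\<^sub>F x in orthant_at_0. x \<in> (orthant :: (real ^ 'n) set)"
    unfolding eventually_orthant_at_0 using zero_less_one by blast
  have orthinf: "\<forall>\<^sub>F x in orthant_at_infinity. x \<in> (orthant :: (real ^ 'n) set)"
    unfolding eventually_orthant_at_infinity by blast
  have "0 \<le> F0"
    unfolding assms(17) by (rule max_limit_nonneg[OF orthant_at_0_neq_bot lim0 orth0 assms(13)])
  moreover have "0 \<le> Finf"
    unfolding assms(18)
    by (rule max_limit_nonneg[OF orthant_at_infinity_neq_bot liminf orthinf assms(13)])
  moreover have "F0 \<noteq> 0" "Finf \<noteq> 0" "F0 \<noteq> \<infinity>" "Finf \<noteq> \<infinity>"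
    using assms(19,20) by (auto simp: num_zeros_def num_infinities_def split: if_splits)
  ultimately obtain A B where AB: "F0 = ereal A" "Finf = ereal B" "0 < A" "0 < B"
    by (cases F0; cases Finf) auto
  have recip: "1 / ereal r = ereal (1 / r)" if "0 < r" for r :: real
    using that by (simp add: one_ereal_def)
  have mx: "1 / max F0 Finf = ereal (1 / max A B)" and mn: "1 / min F0 Finf = ereal (1 / min A B)"
    using AB by (auto simp: max_def min_def recip)
  have lower: "1 / (\<sigma> * \<Gamma>) * (1 / max A B) < \<mu>"
    using assms(21) unfolding mx times_ereal.simps less_ereal.simps .
  have upper: "\<mu> < 1 / \<chi>\<^sub>0 * (1 / min A B)"
    using assms(22) unfolding mn times_ereal.simps less_ereal.simps .
  have "0 < 1 / (\<sigma> * \<Gamma>) * (1 / max A B)"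
    using sigma_bounds(1) Gamma_pos AB(3) by simp
  then have \<mu>: "0 < \<mu>" using lower by linarith
  interpret periodic_system \<omega> a b \<mu>
    by unfold_locales (rule \<mu>)
  \<comment> \<open>Slopes of at least this size are expanded; the lower bound on \<open>\<mu>\<close> puts it
    below the larger of the two limits.\<close>
  define \<eta> where "\<eta> = 1 / (\<mu> * \<Gamma> * \<sigma>)"
  have \<eta>: "0 \<le> \<eta>" "1 \<le> \<mu> * \<Gamma> * (\<sigma> * \<eta>)"
    using \<mu> sigma_bounds(1) Gamma_pos by (simp_all add: \<eta>_def)
  have \<eta>max: "\<eta> < max A B"
    using lower \<mu> sigma_bounds(1) Gamma_pos AB(3) by (simp add: \<eta>_def field_simps)
  \<comment> \<open>Slopes below \<open>1 / (\<mu> * \<chi>\<^sub>0)\<close> are contracted; the upper bound on \<open>\<mu>\<close> puts the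
    smaller limit there.\<close>
  have "min A B < 1 / (\<mu> * \<chi>\<^sub>0)"
    using upper \<mu> chi_pos AB(3,4) by (simp add: field_simps)
  then obtain \<theta> where \<theta>min: "min A B < \<theta>" and \<theta>2: "\<theta> < 1 / (\<mu> * \<chi>\<^sub>0)" using dense by blast
  have \<theta>: "0 \<le> \<theta>" "\<mu> * \<chi>\<^sub>0 * \<theta> < 1"
    using \<theta>min AB(3,4) \<theta>2 \<mu> chi_pos by (simp_all add: field_simps)
  note data = assms(10) per[OF assms(11)] assms(12,13) \<theta> \<eta>
  show ?thesis
  proof (cases "B \<le> A")
    case True
    have "ereal \<eta> < (MAX i. f0 i)" "(MAX i. finf i) < ereal \<theta>"
      using True \<eta>max \<theta>min AB assms(17,18) by (auto simp: max_def min_def split: if_splits)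
    note slopes = eventually_above_slope[OF lim0 this(1)] eventually_below_slope[OF liminf this(2)]
    obtain j \<delta> where \<delta>: "0 < \<delta>"
      and near: "\<forall>x\<in>orthant. 0 < l1norm x \<longrightarrow> l1norm x < \<delta> \<longrightarrow> \<eta> < f j x / l1norm x"
      using slopes(1) unfolding eventually_orthant_at_0 by blast
    obtain N where away: "\<forall>x\<in>orthant. N \<le> l1norm x \<longrightarrow> (\<forall>i. f i x / l1norm x < \<theta>)"
      using slopes(2) unfolding eventually_orthant_at_infinity by blast
    show ?thesis
    proof (rule positive_solution_steep_at_zero[where f = f and j = j and N = "max 1 N",
          OF data \<delta>])
      fix x :: "real ^ 'n" and i assume x: "x \<in> orthant"
      show "\<eta> * l1norm x \<le> f j x" if "0 < l1norm x" "l1norm x < \<delta>"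
        using near x that by (simp add: pos_less_divide_eq less_imp_le)
      show "f i x \<le> \<theta> * l1norm x" if "max 1 N \<le> l1norm x"
      proof -
        have "0 < l1norm x" "N \<le> l1norm x" using that by auto
        moreover from this have "f i x / l1norm x < \<theta>" using away x by blast
        ultimately show ?thesis by (simp add: pos_divide_less_eq less_imp_le)
      qed
    qed
  next
    case False
    have "ereal \<eta> < (MAX i. finf i)" "(MAX i. f0 i) < ereal \<theta>"
      using False \<eta>max \<theta>min AB assms(17,18) by (auto simp: max_def min_def split: if_splits)
    note slopes = eventually_above_slope[OF liminf this(1)] eventually_below_slope[OF lim0 this(2)]
    obtain \<delta> where \<delta>: "0 < \<delta>"
      and near: "\<forall>x\<in>orthant. 0 < l1norm x \<longrightarrow> l1norm x < \<delta> \<longrightarrow> (\<forall>i. f i x / l1norm x < \<theta>)"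
      using slopes(2) unfolding eventually_orthant_at_0 by blast
    obtain j N where away: "\<forall>x\<in>orthant. N \<le> l1norm x \<longrightarrow> \<eta> < f j x / l1norm x"
      using slopes(1) unfolding eventually_orthant_at_infinity by blast
    have "(MAX i. finf i) < ereal (B + 1)" using AB(2) assms(18) by simp
    from eventually_below_slope[OF liminf this]
    obtain N' where far: "\<forall>x\<in>orthant. N' \<le> l1norm x \<longrightarrow> (\<forall>i. f i x / l1norm x < B + 1)"
      unfolding eventually_orthant_at_infinity by blast
    obtain C where C: "0 \<le> C" "\<forall>i. \<forall>x\<in>orthant. l1norm x \<le> N' \<longrightarrow> f i x \<le> C"
      using bounded_on_orthant_ball[of f, OF assms(12)] by blast
    \<comment> \<open>The three terms bound the slope near 0, near infinity and on the compact
      shell in between.\<close>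
    define D where "D = max \<theta> (max (B + 1) (C / \<delta>))"
    have D: "0 \<le> D" "\<theta> \<le> D" "B + 1 \<le> D" "C / \<delta> \<le> D" using \<theta>(1) by (auto simp: D_def)
    have lin: "f i x \<le> D * l1norm x" if x: "x \<in> orthant" "0 < l1norm x" for i x
    proof -
      consider "l1norm x < \<delta>" | "N' \<le> l1norm x" | "\<delta> \<le> l1norm x" "l1norm x \<le> N'" by linarith
      then show ?thesis
      proof cases
        case 1
        then have "f i x / l1norm x < \<theta>" using near x by blast
        then have "f i x / l1norm x \<le> D" using D(2) by linarith
        then show ?thesis using x by (simp add: pos_divide_le_eq)
      next
        case 2
        then have "f i x / l1norm x < B + 1" using far x by blast
        then have "f i x / l1norm x \<le> D" using D(3) by linarith
        then show ?thesis using x by (simp add: pos_divide_le_eq)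
      next
        case 3
        have "f i x \<le> C" using C(2) x 3 by blast
        also have "\<dots> = C / \<delta> * \<delta>" using \<delta> by simp
        also have "\<dots> \<le> D * l1norm x" using D C \<delta> 3 by (intro mult_mono) auto
        finally show ?thesis .
      qed
    qed
    show ?thesis
    proof (rule positive_solution_steep_at_infinity[where f = f and j = j and N = "max 1 N",
          OF data _ \<delta> _ lin D(1)])
      fix x :: "real ^ 'n" and i assume x: "x \<in> orthant"
      show "\<eta> * l1norm x \<le> f j x" if "max 1 N \<le> l1norm x"
      proof -
        have "0 < l1norm x" "N \<le> l1norm x" using that by auto
        moreover from this have "\<eta> < f j x / l1norm x" using away x by blast
        ultimately show ?thesis by (simp add: pos_less_divide_eq less_imp_le)
      qed
      show "f i x \<le> \<theta> * l1norm x" if "0 < l1norm x" "l1norm x < \<delta>"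
        using near x that by (simp add: pos_divide_less_eq less_imp_le)
    qed
  qed
qed

end
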